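(* For any $d\in\mathbb{N}=\{1,2,\ldots\}$ and $b>0$ there exists a constant $C$ such that the following holds for all integers $n\ge d+1$ and all $\theta\in\Theta_n=(0,n-1)\cap(0,b]$. Let $G_n$ be the Erdős–Rényi random graph on $n$ vertices, with edges connecting each distinct pair of vertices independently with probability $\theta/(n-1)$; let $Y_n$ be the number of vertices of $G_n$ having degree $d$; let $\mu_{n,\theta}$ and $\sigma_{n,\theta}^2$ be the mean and variance of $Y_n$; and let $W_{n,\theta}=(Y_n-\mu_{n,\theta})/\sigma_{n,\theta}$. Then $$\sup_{z\in\mathbb{R}}\big|P_\theta(W_{n,\theta}\le z)-P(Z\le z)\big|\le \frac{C}{r_{n,\theta}},$$ where $Z$ is a standard normal random variable and $$r_{n,\theta}=\sqrt{n\tau_\theta}\qquad\text{with}\qquad \tau_\theta=\frac{e^{-\theta}\theta^d}{d!}.$$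
   Context: $G_n$ has vertex set $\{1,\ldots,n\}$; the edge indicators $\xi_{u,v}=\xi_{v,u}$ for distinct vertices $u,v$ are independent Bernoulli variables with common success probability $\theta/(n-1)$, and there are no loops ($\xi_{u,u}=0$). The degree of $v$ is $D_n(v)=\sum_w \xi_{v,w}$, and $Y_n=\sum_v \mathbf{1}(D_n(v)=d)$. $P_\theta$ denotes probability when the parameter is $\theta$. Explicitly, with $$\tau_{n,\theta}=\binom{n-1}{d}\left(\frac{\theta}{n-1}\right)^d\left(1-\frac{\theta}{n-1}\right)^{n-1-d},$$ one has $\mu_{n,\theta}=n\tau_{n,\theta}$ and $\sigma_{n,\theta}^2=n\tau_{n,\theta}^2\left[\frac{(d-\theta)^2}{\theta(1-\theta/(n-1))}-1\right]+n\tau_{n,\theta}$. *)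

theory Defs
  imports "HOL-Probability.Probability"
begin

definition vertex_pairs :: "nat \<Rightarrow> nat set set" where
  "vertex_pairs n = {e. e \<subseteq> {1..n} \<and> card e = 2}"

text \<open>A graph on \<open>{1..n}\<close> is encoded by the indicator function of its edge set,
  an edge being a two-element vertex set.\<close>

definition erdos_renyi :: "nat \<Rightarrow> real \<Rightarrow> (nat set \<Rightarrow> bool) pmf" where
  "erdos_renyi n p = Pi_pmf (vertex_pairs n) False (\<lambda>_. bernoulli_pmf p)"

text \<open>\<open>bernoulli_pmf\<close> truncates its parameter to \<open>[0, 1]\<close>; for
  \<open>0 < \<theta> < n - 1\<close> no truncation takes place below.\<close>

definition G_dist :: "nat \<Rightarrow> real \<Rightarrow> (nat set \<Rightarrow> bool) pmf" where
  "G_dist n \<theta> = erdos_renyi n (\<theta> / (real n - 1))"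

definition edge_ind :: "(nat set \<Rightarrow> bool) \<Rightarrow> nat \<Rightarrow> nat \<Rightarrow> nat" where
  "edge_ind G u v = of_bool (u \<noteq> v \<and> G {u, v})"

definition vdegree :: "nat \<Rightarrow> (nat set \<Rightarrow> bool) \<Rightarrow> nat \<Rightarrow> nat" where
  "vdegree n G v = (\<Sum>w\<in>{1..n}. edge_ind G v w)"

definition Y_count :: "nat \<Rightarrow> nat \<Rightarrow> (nat set \<Rightarrow> bool) \<Rightarrow> real" where
  "Y_count d n G = (\<Sum>v\<in>{1..n}. of_bool (vdegree n G v = d))"

definition mean_Y :: "nat \<Rightarrow> nat \<Rightarrow> real \<Rightarrow> real" where
  "mean_Y d n \<theta> = measure_pmf.expectation (G_dist n \<theta>) (Y_count d n)"

definition sigma_Y :: "nat \<Rightarrow> nat \<Rightarrow> real \<Rightarrow> real" where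
  "sigma_Y d n \<theta> = sqrt (measure_pmf.variance (G_dist n \<theta>) (Y_count d n))"

definition W_std :: "nat \<Rightarrow> nat \<Rightarrow> real \<Rightarrow> (nat set \<Rightarrow> bool) \<Rightarrow> real" where
  "W_std d n \<theta> G = (Y_count d n G - mean_Y d n \<theta>) / sigma_Y d n \<theta>"

definition tau_poisson :: "nat \<Rightarrow> real \<Rightarrow> real" where
  "tau_poisson d \<theta> = exp (- \<theta>) * \<theta> ^ d / fact d"

definition r_rate :: "nat \<Rightarrow> nat \<Rightarrow> real \<Rightarrow> real" where
  "r_rate d n \<theta> = sqrt (real n * tau_poisson d \<theta>)"

end

theory Submission
  imports Defs "HOL-Real_Asymp.Real_Asymp"
begin

text \<open>
  Regard \<open>Y\<close> as a function of the independent edge indicators \<open>X\<^sub>e\<close> and write \<open>D\<^sub>e\<close> for the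
  difference of its values with and without the edge \<open>e\<close>. Since \<open>Y\<close> is a sum over vertices of
  functions of binomial degrees, the Poisson equation \<open>\<Sum>\<^sub>e (X\<^sub>e - p) D\<^sub>e h = Y - E Y\<close> has the explicit
  solution \<open>h = \<Sum>\<^sub>v g (deg v)\<close>, where \<open>g\<close> solves the Stein equation of the binomial law and has
  bounded increments.

  Integration by parts gives \<open>E ((Y - E Y) f) = p (1 - p) \<Sum>\<^sub>e E (D\<^sub>e h D\<^sub>e f)\<close>. For a Stein solution
  \<open>f\<close> of the normal law, \<open>f'\<close> is a difference of monotone functions up to a constant, so the
  linearisation error of \<open>D\<^sub>e f (W)\<close> is dominated by the \<open>D\<^sub>e\<close> of a bounded function; integrating by
  parts backwards, the Kolmogorov distance is at most a constant times
  \<open>(E \<bar>T - \<sigma>\<^sup>2\<bar> + E \<bar>R\<bar>) / \<sigma>\<^sup>2\<close> with \<open>T = p (1 - p) \<Sum>\<^sub>e D\<^sub>e h D\<^sub>e Y\<close> and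
  \<open>R = \<Sum>\<^sub>e (X\<^sub>e - p) \<bar>D\<^sub>e h\<bar> D\<^sub>e Y\<close>. The first term is controlled by the Poincare inequality, the
  second by expanding \<open>E R\<^sup>2\<close>. Only edges sharing a vertex interact, and the summand at \<open>e\<close> vanishes
  unless an endpoint has degree at least \<open>d - 1\<close>; hence both second moments are \<open>O (n \<theta>\<^sup>d)\<close>, while
  \<open>\<sigma>\<^sup>2\<close> is at least of order \<open>n \<theta>\<^sup>d\<close>, because the indicators of distinct vertices are positively
  correlated.
\<close>

section \<open>The Stein equation of the normal law\<close>

abbreviation Phi :: "real \<Rightarrow> real" where
  "Phi \<equiv> cdf std_normal_distribution"

interpretation std_normal: real_distribution std_normal_distribution
  by (rule real_dist_normal_dist)

lemma std_normal_density_deriv: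
  "(std_normal_density has_real_derivative - x * std_normal_density x) (at x)"
proof -
  have "((\<lambda>x. 1 / sqrt (2 * pi) * exp (- x\<^sup>2 / 2)) has_real_derivative
          1 / sqrt (2 * pi) * (exp (- x\<^sup>2 / 2) * (- x))) (at x)"
    by (rule DERIV_cmult) (auto intro!: derivative_eq_intros)
  moreover have "std_normal_density = (\<lambda>x. 1 / sqrt (2 * pi) * exp (- x\<^sup>2 / 2))"
    by (simp add: std_normal_density_def fun_eq_iff)
  ultimately show ?thesis by (simp add: mult_ac)
qed

lemma Phi_deriv: "(Phi has_real_derivative std_normal_density x) (at x)"
proof -
  \<comment> \<open>\<open>Phi\<close> itself integrates over a half line. Measured from a base
    point left of \<open>x\<close>, its increment is an integral over a compact interval with
    \<open>x\<close> in the interior, to which the fundamental theorem applies.\<close>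
  define a where "a = x - 1"
  have int: "Phi y - Phi a = integral {a..y} std_normal_density" if "a \<le> y" for y
  proof -
    have "Phi y - Phi a = measure std_normal_distribution {a<..y}"
    proof (cases "a = y")
      case False
      with that show ?thesis by (intro std_normal.cdf_diff_eq) simp
    qed simp
    also have "\<dots> = measure std_normal_distribution {a..y}"
    proof -
      have "AE t in lborel. (t \<in> {a<..y}) = (t \<in> {a..y})"
        using AE_lborel_singleton[of a] by (rule AE_mp) (auto intro!: AE_I2)
      then have "AE t in std_normal_distribution. (t \<in> {a<..y}) = (t \<in> {a..y})"
        by (subst AE_density) auto
      then show ?thesis by (intro std_normal.finite_measure_eq_AE) auto
    qed
    also have "\<dots> = (LINT t:{a..y}|lborel. std_normal_density t)"
    proof -
      have "measure std_normal_distribution {a..y} = (LINT t|std_normal_distribution. indicator {a..y} t)"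
        by simp
      also have "\<dots> = (LINT t|lborel. std_normal_density t *\<^sub>R indicator {a..y} t)"
        by (subst integral_density) auto
      also have "\<dots> = (LINT t:{a..y}|lborel. std_normal_density t)"
        unfolding set_lebesgue_integral_def
        by (intro Bochner_Integration.integral_cong) auto
      finally show ?thesis .
    qed
    also have "\<dots> = integral {a..y} std_normal_density"
    proof (rule set_borel_integral_eq_integral)
      have "integrable lborel std_normal_density"
        using integrable_std_normal_moment[of 0] by simp
      then show "set_integrable lborel {a..y} std_normal_density"
        unfolding set_integrable_def by (intro integrable_mult_indicator) auto
    qed
    finally show ?thesis .
  qed
  have cont: "continuous_on {a..x+1} std_normal_density"
    by (intro DERIV_continuous_on) (use std_normal_density_deriv DERIV_subset in blast)
  have "((\<lambda>y. integral {a..y} std_normal_density) has_real_derivative std_normal_density x)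
          (at x within {a..x+1})"
    by (rule integral_has_real_derivative[OF cont]) (auto simp: a_def)
  moreover have "at x within {a..x+1} = at x"
    by (rule at_within_interior) (auto simp: a_def)
  ultimately have "((\<lambda>y. integral {a..y} std_normal_density + Phi a) has_real_derivative std_normal_density x) (at x)"
    by (auto intro!: derivative_eq_intros)
  then show ?thesis
  proof (rule DERIV_cong_ev[THEN iffD1, rotated -1, OF _ refl _ refl])
    show "\<forall>\<^sub>F y in nhds x. integral {a..y} std_normal_density + Phi a = Phi y"
      using eventually_nhds_in_open[of "{a<..}" x]
      by (rule eventually_mono) (auto simp: a_def int[unfolded a_def, symmetric])
  qed
qed

section \<open>Symmetry and tail bounds of the normal law\<close>

lemma std_normal_density_minus [simp]: "std_normal_density (- x) = std_normal_density x"
  by (simp add: std_normal_density_def)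

text \<open>The sum \<open>Phi x + Phi (- x)\<close> has derivative 0, so it equals its limit 1 at
  infinity.\<close>

lemma Phi_minus: "Phi (- x) = 1 - Phi x"
proof -
  have "((\<lambda>x. Phi x + Phi (- x)) has_real_derivative 0) (at y)" for y
  proof -
    have "((\<lambda>x. Phi (- x)) has_real_derivative std_normal_density (- y) * (- 1)) (at y)"
      by (rule DERIV_chain2[where f = Phi, OF Phi_deriv]) (auto intro!: derivative_eq_intros)
    from DERIV_add[OF Phi_deriv this] show ?thesis by simp
  qed
  then have const: "Phi x + Phi (- x) = Phi y + Phi (- y)" for y
    by (rule DERIV_isconst_all[rule_format])
  have "((\<lambda>y. Phi y + Phi (- y)) \<longlongrightarrow> 1 + 0) at_top"
    by (intro tendsto_add std_normal.cdf_lim_at_top_prob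
        filterlim_compose[OF std_normal.cdf_lim_at_bot filterlim_uminus_at_bot_at_top])
  moreover have "((\<lambda>y. Phi y + Phi (- y)) \<longlongrightarrow> Phi x + Phi (- x)) at_top"
    by (subst const[symmetric]) simp
  ultimately have "Phi x + Phi (- x) = 1 + 0"
    using tendsto_unique trivial_limit_at_top_linorder by blast
  then show ?thesis by simp
qed

text \<open>Both sides of each tail inequality below tend to 0 at minus infinity, so comparing
  derivatives is enough.\<close>

lemma nonneg_of_deriv_nonneg_at_bot:
  fixes q :: "real \<Rightarrow> real"
  assumes "\<And>x. x < c \<Longrightarrow> (q has_real_derivative q' x) (at x)" "\<And>x. x < c \<Longrightarrow> 0 \<le> q' x"
    and "(q \<longlongrightarrow> 0) at_bot" and "x < c"
  shows "0 \<le> q x"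
proof (rule tendsto_upperbound[OF assms(3)])
  have "q y \<le> q x" if "y \<le> x" for y
  proof (rule DERIV_nonneg_imp_nondecreasing[OF that])
    fix t assume "t \<le> x"
    with assms show "\<exists>D. (q has_real_derivative D) (at t) \<and> 0 \<le> D"
      by (intro exI[of _ "q' t"]) auto
  qed
  then show "\<forall>\<^sub>F y in at_bot. q y \<le> q x"
    by (auto simp: eventually_at_bot_linorder)
qed simp

lemma std_normal_density_at_bot: "(std_normal_density \<longlongrightarrow> 0) at_bot"
  unfolding std_normal_density_def by real_asymp

text \<open>Divided by \<open>- x\<close>, the claim says that
  \<open>- Phi x - std_normal_density x / x\<close> is nonnegative. On the negative axis the
  derivative of this function is the density divided by the square of the argument.\<close>

lemma Mills_upper:
  assumes "x < 0"
  shows "- x * Phi x \<le> std_normal_density x"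
proof -
  have "0 \<le> - Phi x - std_normal_density x / x"
  proof (rule nonneg_of_deriv_nonneg_at_bot[OF _ _ _ assms])
    show "((\<lambda>x. - Phi x - std_normal_density x / x) has_real_derivative std_normal_density y / y\<^sup>2) (at y)"
      if "y < 0" for y
    proof -
      have "((\<lambda>x. - Phi x - std_normal_density x / x) has_real_derivative
          - std_normal_density y - ((- y * std_normal_density y) * y - std_normal_density y * 1) / (y * y)) (at y)"
        using that by (intro DERIV_diff DERIV_minus DERIV_divide Phi_deriv std_normal_density_deriv DERIV_ident) auto
      also have "- std_normal_density y - ((- y * std_normal_density y) * y - std_normal_density y * 1) / (y * y) =
          std_normal_density y / y\<^sup>2"
        using that by (simp add: field_simps power2_eq_square)
      finally show ?thesis .
    qed
    have "((\<lambda>x. 1 / x) \<longlongrightarrow> (0::real)) at_bot" by real_asymp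
    from tendsto_mult[OF std_normal_density_at_bot this]
    have "((\<lambda>x. std_normal_density x / x) \<longlongrightarrow> 0) at_bot" by simp
    from tendsto_diff[OF tendsto_minus[OF std_normal.cdf_lim_at_bot] this]
    show "((\<lambda>x. - Phi x - std_normal_density x / x) \<longlongrightarrow> 0) at_bot" by simp
  qed auto
  then show ?thesis using assms by (simp add: field_simps)
qed

text \<open>The derivative collapses to twice the density over
  \<open>(1 + y\<^sup>2)\<^sup>2\<close>, which is positive on the whole line. The cutoff
  \<open>x + 1\<close> only supplies a point strictly to the right of \<open>x\<close>.\<close>

lemma Mills_lower: "0 \<le> Phi x + x * std_normal_density x / (1 + x\<^sup>2)"
proof (rule nonneg_of_deriv_nonneg_at_bot[where c = "x + 1"
      and q = "\<lambda>x. Phi x + x * std_normal_density x / (1 + x\<^sup>2)"])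
  show "((\<lambda>x. Phi x + x * std_normal_density x / (1 + x\<^sup>2)) has_real_derivative
          2 * std_normal_density y / (1 + y\<^sup>2)\<^sup>2) (at y)" for y
  proof -
    have pos: "1 + y * y \<noteq> 0" by (smt (verit) zero_le_square)
    have "((\<lambda>x. Phi x + x * std_normal_density x / (1 + x\<^sup>2)) has_real_derivative
      std_normal_density y + ((std_normal_density y + y * (- y * std_normal_density y)) * (1 + y\<^sup>2)
        - y * std_normal_density y * (2 * y)) / ((1 + y\<^sup>2) * (1 + y\<^sup>2))) (at y)"
      by (rule derivative_eq_intros Phi_deriv std_normal_density_deriv refl
         | use pos in \<open>simp add: power2_eq_square algebra_simps\<close>)+
    also have "std_normal_density y + ((std_normal_density y + y * (- y * std_normal_density y)) * (1 + y\<^sup>2)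
        - y * std_normal_density y * (2 * y)) / ((1 + y\<^sup>2) * (1 + y\<^sup>2)) = 2 * std_normal_density y / (1 + y\<^sup>2)\<^sup>2"
      using pos by (simp add: divide_simps) (simp add: algebra_simps power2_eq_square power4_eq_xxxx)
    finally show ?thesis .
  qed
  have "((\<lambda>x. x / (1 + x\<^sup>2)) \<longlongrightarrow> (0::real)) at_bot" by real_asymp
  from tendsto_mult[OF std_normal_density_at_bot this]
  have "((\<lambda>x. x * std_normal_density x / (1 + x\<^sup>2)) \<longlongrightarrow> 0) at_bot" by (simp add: mult_ac)
  from tendsto_add[OF std_normal.cdf_lim_at_bot this]
  show "((\<lambda>x. Phi x + x * std_normal_density x / (1 + x\<^sup>2)) \<longlongrightarrow> 0) at_bot" by simp
qed auto

text \<open>The Mills ratio of the left tail; it solves \<open>m' = x * m + 1\<close>, the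
  homogeneous Stein equation with a unit source.\<close>

definition Mills :: "real \<Rightarrow> real" where
  "Mills x = Phi x / std_normal_density x"

lemma Mills_nonneg: "0 \<le> Mills x"
  by (simp add: Mills_def std_normal.cdf_nonneg)

lemma Mills_deriv: "(Mills has_real_derivative x * Mills x + 1) (at x)"
proof -
  have pos: "std_normal_density x \<noteq> 0" by (simp add: less_imp_neq[OF normal_density_pos, symmetric])
  show ?thesis unfolding Mills_def
    by (rule derivative_eq_intros Phi_deriv std_normal_density_deriv refl pos
       | use pos in \<open>simp add: field_simps\<close>)+
qed

text \<open>The derivative \<open>(1 + t\<^sup>2) * Mills t + t\<close> is a positive multiple of
  the expression in \<open>Mills_lower\<close>.\<close>

lemma mono_id_Mills: "x \<le> y \<Longrightarrow> x * Mills x \<le> y * Mills y"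
proof (rule DERIV_nonneg_imp_nondecreasing[where f = "\<lambda>t. t * Mills t"])
  fix t
  have "0 \<le> (1 + t\<^sup>2) * (Phi t + t * std_normal_density t / (1 + t\<^sup>2)) / std_normal_density t"
    using Mills_lower[of t] by (intro mult_nonneg_nonneg divide_nonneg_nonneg) auto
  also have "\<dots> = Mills t + t * (t * Mills t + 1)"
  proof -
    have pos: "1 + t * t \<noteq> 0" by (smt (verit) zero_le_square)
    have pos': "std_normal_density t \<noteq> 0" by (simp add: less_imp_neq[OF normal_density_pos, symmetric])
    show ?thesis
      using pos pos' by (simp add: Mills_def power2_eq_square divide_simps) (simp add: algebra_simps)
  qed
  finally have "0 \<le> Mills t + t * (t * Mills t + 1)" .
  moreover have "((\<lambda>t. t * Mills t) has_real_derivative Mills t + t * (t * Mills t + 1)) (at t)"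
    by (auto intro!: derivative_eq_intros Mills_deriv)
  ultimately show "\<exists>y. ((\<lambda>t. t * Mills t) has_real_derivative y) (at t) \<and> 0 \<le> y" by blast
qed

lemma neg_id_Mills_le_1: "- x * Mills x \<le> 1"
proof (cases "x < 0")
  case True
  then show ?thesis
    using Mills_upper[OF True] normal_density_pos[of 1 0 x] by (simp add: Mills_def field_simps)
next
  case False
  then have "0 \<le> x * Mills x" using Mills_nonneg by simp
  then show ?thesis by simp
qed

text \<open>Reflection exchanges the two cdf factors: the product becomes
  \<open>x * Mills (- x)\<close>, at most 1 by the upper tail bound, times
  \<open>Phi x\<close>.\<close>

lemma id_Mills_tail_le_1: "x * Mills x * (1 - Phi x) \<le> 1"
proof -
  have "x * Mills x * (1 - Phi x) = (x * Mills (- x)) * Phi x"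
    by (simp add: Mills_def Phi_minus)
  also have "\<dots> \<le> 1 * 1"
  proof (cases "0 \<le> x * Mills (- x)")
    case True
    then show ?thesis
      using neg_id_Mills_le_1[of "- x"]
      by (intro mult_mono) (auto simp: std_normal.cdf_nonneg std_normal.cdf_bounded_prob)
  next
    case False
    then show ?thesis
      using mult_nonpos_nonneg[of "x * Mills (- x)" "Phi x"] by (simp add: std_normal.cdf_nonneg)
  qed
  finally show ?thesis by simp
qed

text \<open>The solution of \<open>f' w = w * f w + of_bool (w \<le> z) - Phi z\<close> for which
  \<open>w * f w\<close> stays bounded. The branches agree at \<open>z\<close>, since both equal
  \<open>Phi z * (1 - Phi z)\<close> over the density there.\<close>

definition stein_sol :: "real \<Rightarrow> real \<Rightarrow> real" where
  "stein_sol z w = (if w \<le> z then (1 - Phi z) * Mills w else Phi z * Mills (- w))"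

lemma stein_sol_right: "z \<le> w \<Longrightarrow> stein_sol z w = Phi z * Mills (- w)"
  by (auto simp: stein_sol_def Mills_def Phi_minus)

lemma stein_sol_left: "w \<le> z \<Longrightarrow> stein_sol z w = (1 - Phi z) * Mills w"
  by (auto simp: stein_sol_def)

lemma mono_id_stein_sol:
  assumes "x \<le> y"
  shows "x * stein_sol z x \<le> y * stein_sol z y"
proof -
  have left: "x * stein_sol z x \<le> y * stein_sol z y" if "x \<le> y" "y \<le> z" for x y
    using that mult_left_mono[OF mono_id_Mills[OF that(1)], of "1 - Phi z"]
    by (simp add: stein_sol_left mult_ac std_normal.cdf_bounded_prob)
  have right: "x * stein_sol z x \<le> y * stein_sol z y" if "x \<le> y" "z \<le> x" for x y
    using that mult_left_mono[OF mono_id_Mills[of "- y" "- x"], of "Phi z"]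
    by (simp add: stein_sol_right mult_ac std_normal.cdf_nonneg)
  show ?thesis
    using left[of x y] right[of x y] left[of x z] right[of z y] assms
    by (cases "y \<le> z"; cases "z \<le> x") auto
qed

text \<open>On each side of \<open>z\<close>, monotonicity compares with the value at
  \<open>z\<close>, which \<open>id_Mills_tail_le_1\<close> controls; the opposite inequality is the
  Mills bound \<open>neg_id_Mills_le_1\<close>, scaled by a probability.\<close>

lemma id_stein_sol_bound: "\<bar>w * stein_sol z w\<bar> \<le> 1"
proof -
  have Phi01: "0 \<le> Phi z" "Phi z \<le> 1" by (auto simp: std_normal.cdf_nonneg std_normal.cdf_bounded_prob)
  have z_upper: "z * stein_sol z z \<le> 1"
    using id_Mills_tail_le_1[of z] by (simp add: stein_sol_left mult_ac)
  have z_lower: "- 1 \<le> z * stein_sol z z"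
    using id_Mills_tail_le_1[of "- z"] by (simp add: stein_sol_right Phi_minus mult_ac)
  have small: "c * a \<le> 1" if "a \<le> 1" "0 \<le> c" "c \<le> 1" for a c :: real
    using mult_mono[of c 1 "max a 0" 1] mult_left_mono[of a "max a 0" c] that by auto
  show ?thesis
  proof (cases "w \<le> z")
    case True
    have "(1 - Phi z) * (- w * Mills w) \<le> 1"
      using neg_id_Mills_le_1[of w] Phi01 by (intro small[of "- w * Mills w"]) auto
    then show ?thesis
      using mono_id_stein_sol[OF True, of z] z_upper True
      by (simp add: abs_le_iff stein_sol_left mult_ac)
  next
    case False
    have "Phi z * (w * Mills (- w)) \<le> 1"
      using neg_id_Mills_le_1[of "- w"] Phi01 by (intro small[of "w * Mills (- w)"]) auto
    then show ?thesis
      using mono_id_stein_sol[of z w z] z_lower False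
      by (simp add: abs_le_iff stein_sol_right mult_ac)
  qed
qed

text \<open>The Stein equation for \<open>stein_sol z\<close> reads \<open>f' = stein_rhs z\<close> off the point \<open>z\<close>.\<close>

definition stein_rhs :: "real \<Rightarrow> real \<Rightarrow> real" where
  "stein_rhs z w = w * stein_sol z w + of_bool (w \<le> z) - Phi z"

text \<open>\<open>stein_rhs\<close> adds an increasing function and a decreasing indicator.
  Flipping the sign of the indicator gives an increasing function whose increments dominate the
  oscillation of \<open>stein_rhs\<close>.\<close>

definition stein_mono :: "real \<Rightarrow> real \<Rightarrow> real" where
  "stein_mono z w = w * stein_sol z w - of_bool (w \<le> z)"

lemma stein_rhs_bound: "\<bar>stein_rhs z w\<bar> \<le> 2"
  using id_stein_sol_bound[of w z] std_normal.cdf_nonneg[of z] std_normal.cdf_bounded_prob[of z]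
  by (auto simp: stein_rhs_def abs_le_iff)

lemma stein_mono_bound: "\<bar>stein_mono z w\<bar> \<le> 2"
  using id_stein_sol_bound[of w z] by (auto simp: stein_mono_def abs_le_iff)

text \<open>The derivative is extremal when its increasing part is read at one end of the interval
  and its decreasing indicator at the other. The solution has a kink at \<open>z\<close>, so the
  mean value theorem is applied on each side separately.\<close>

lemma stein_sol_increment_bounds:
  assumes "x \<le> y"
  shows "(y - x) * (x * stein_sol z x + of_bool (y \<le> z) - Phi z) \<le> stein_sol z y - stein_sol z x"
    and "stein_sol z y - stein_sol z x \<le> (y - x) * (y * stein_sol z y + of_bool (x \<le> z) - Phi z)"
proof -
  let ?f = "stein_sol z"
  have mvt: "(b - a) * m \<le> F b - F a \<and> F b - F a \<le> (b - a) * M"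
    if "a \<le> b" "\<And>t. (F has_real_derivative F' t) (at t)" "\<And>t. a \<le> t \<Longrightarrow> t \<le> b \<Longrightarrow> m \<le> F' t \<and> F' t \<le> M"
    for F F' a b m M
  proof (cases "a = b")
    case False
    with that(1) have "a < b" by simp
    from MVT2[OF this that(2)] obtain t where "a < t" "t < b" "F b - F a = (b - a) * F' t" by blast
    then show ?thesis using that(3)[of t] \<open>a < b\<close> by (auto intro!: mult_left_mono)
  qed simp
  have left: "(b - a) * (a * ?f a + 1 - Phi z) \<le> ?f b - ?f a \<and> ?f b - ?f a \<le> (b - a) * (b * ?f b + 1 - Phi z)"
    if "a \<le> b" "b \<le> z" for a b
  proof -
    let ?F = "\<lambda>w. (1 - Phi z) * Mills w"
    have "(?F has_real_derivative (1 - Phi z) * (t * Mills t + 1)) (at t)" for t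
      by (auto intro!: derivative_eq_intros Mills_deriv)
    moreover have "(1 - Phi z) * (t * Mills t + 1) = t * ?f t + 1 - Phi z" if "t \<le> b" for t
      using that \<open>b \<le> z\<close> by (simp add: stein_sol_left algebra_simps)
    ultimately have "(b - a) * (a * ?f a + 1 - Phi z) \<le> ?F b - ?F a \<and> ?F b - ?F a \<le> (b - a) * (b * ?f b + 1 - Phi z)"
      using that by (intro mvt) (auto intro!: mono_id_stein_sol)
    then show ?thesis using that by (simp add: stein_sol_left)
  qed
  have right: "(b - a) * (a * ?f a - Phi z) \<le> ?f b - ?f a \<and> ?f b - ?f a \<le> (b - a) * (b * ?f b - Phi z)"
    if "a \<le> b" "z \<le> a" for a b
  proof -
    let ?F = "\<lambda>w. Phi z * Mills (- w)"
    have "(?F has_real_derivative Phi z * ((- t * Mills (- t) + 1) * (- 1))) (at t)" for t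
      by (intro DERIV_cmult DERIV_chain2[where f = Mills] Mills_deriv) (auto intro!: derivative_eq_intros)
    moreover have "Phi z * ((- t * Mills (- t) + 1) * (- 1)) = t * ?f t - Phi z" if "a \<le> t" for t
      using that \<open>z \<le> a\<close> by (simp add: stein_sol_right algebra_simps)
    ultimately have "(b - a) * (a * ?f a - Phi z) \<le> ?F b - ?F a \<and> ?F b - ?F a \<le> (b - a) * (b * ?f b - Phi z)"
      using that by (intro mvt) (auto intro!: mono_id_stein_sol)
    then show ?thesis using that by (simp add: stein_sol_right)
  qed
  have "(y - x) * (x * ?f x + of_bool (y \<le> z) - Phi z) \<le> ?f y - ?f x \<and>
        ?f y - ?f x \<le> (y - x) * (y * ?f y + of_bool (x \<le> z) - Phi z)"
  proof (cases "y \<le> z")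
    case True
    then show ?thesis using left[OF assms] assms by simp
  next
    case False
    show ?thesis
    proof (cases "x \<le> z")
      \<comment> \<open>The interval crosses the kink: the increments over \<open>[x, z]\<close> and
        \<open>[z, y]\<close> are bounded separately, with the weaker end values, and added.\<close>
      case xz: True
      have L: "(z - x) * (x * ?f x - Phi z) \<le> (z - x) * (x * ?f x + 1 - Phi z)"
        "(z - x) * (z * ?f z + 1 - Phi z) \<le> (z - x) * (y * ?f y + 1 - Phi z)"
        using xz False mono_id_stein_sol[of z y z] by (auto intro!: mult_left_mono)
      have R: "(y - z) * (x * ?f x - Phi z) \<le> (y - z) * (z * ?f z - Phi z)"
        "(y - z) * (y * ?f y - Phi z) \<le> (y - z) * (y * ?f y + 1 - Phi z)"
        using xz False mono_id_stein_sol[of x z z] by (auto intro!: mult_left_mono)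
      have "(y - x) * (x * ?f x - Phi z) = (z - x) * (x * ?f x - Phi z) + (y - z) * (x * ?f x - Phi z)"
        "(y - x) * (y * ?f y + 1 - Phi z) = (z - x) * (y * ?f y + 1 - Phi z) + (y - z) * (y * ?f y + 1 - Phi z)"
        by (simp_all add: algebra_simps)
      moreover have "(z - x) * (x * ?f x + 1 - Phi z) \<le> ?f z - ?f x"
        "?f z - ?f x \<le> (z - x) * (z * ?f z + 1 - Phi z)"
        "(y - z) * (z * ?f z - Phi z) \<le> ?f y - ?f z" "?f y - ?f z \<le> (y - z) * (y * ?f y - Phi z)"
        using left[of x z] right[of z y] xz False by auto
      ultimately have "(y - x) * (x * ?f x - Phi z) \<le> ?f y - ?f x"
        "?f y - ?f x \<le> (y - x) * (y * ?f y + 1 - Phi z)"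
        using L R by linarith+
      then show ?thesis using xz False by simp
    next
      case xz: False
      then show ?thesis using right[OF assms] assms by simp
    qed
  qed
  then show "(y - x) * (x * ?f x + of_bool (y \<le> z) - Phi z) \<le> ?f y - ?f x"
    and "?f y - ?f x \<le> (y - x) * (y * ?f y + of_bool (x \<le> z) - Phi z)" by auto
qed

text \<open>At either end \<open>stein_rhs\<close> lies between the two slopes of
  \<open>stein_sol_increment_bounds\<close>, whose gap is exactly the increment of
  \<open>stein_mono\<close>. No order between \<open>x\<close> and \<open>y\<close> is assumed
  because adding an edge may raise or lower the count.\<close>

lemma stein_sol_increment:
  assumes "w = x \<or> w = y"
  shows "\<bar>stein_sol z y - stein_sol z x - (y - x) * stein_rhs z w\<bar>
           \<le> (y - x) * (stein_mono z y - stein_mono z x)"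
proof -
  have *: "\<bar>stein_sol z y - stein_sol z x - (y - x) * stein_rhs z w\<bar>
           \<le> (y - x) * (stein_mono z y - stein_mono z x)" if xy: "x \<le> y" "w = x \<or> w = y" for x y
  proof -
    let ?m = "x * stein_sol z x + of_bool (y \<le> z) - Phi z"
    let ?M = "y * stein_sol z y + of_bool (x \<le> z) - Phi z"
    have "?m \<le> stein_rhs z w \<and> stein_rhs z w \<le> ?M"
      using mono_id_stein_sol[of x y z] xy by (auto simp: stein_rhs_def)
    then have "(y - x) * ?m \<le> (y - x) * stein_rhs z w" "(y - x) * stein_rhs z w \<le> (y - x) * ?M"
      using xy by (auto intro!: mult_left_mono)
    moreover have "(y - x) * (stein_mono z y - stein_mono z x) = (y - x) * ?M - (y - x) * ?m"
      by (simp add: stein_mono_def algebra_simps)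
    ultimately show ?thesis
      using stein_sol_increment_bounds[OF xy(1), of z] by linarith
  qed
  show ?thesis
  proof (cases "x \<le> y")
    case True
    then show ?thesis using * assms by blast
  next
    case False
    then have "\<bar>stein_sol z x - stein_sol z y - (x - y) * stein_rhs z w\<bar>
           \<le> (x - y) * (stein_mono z x - stein_mono z y)"
      using *[of y x] assms by auto
    also have "\<dots> = (y - x) * (stein_mono z y - stein_mono z x)" by (simp add: algebra_simps)
    also have "\<bar>stein_sol z x - stein_sol z y - (x - y) * stein_rhs z w\<bar> =
        \<bar>stein_sol z y - stein_sol z x - (y - x) * stein_rhs z w\<bar>"
      by (subst abs_minus_cancel[symmetric]) (simp add: algebra_simps)
    finally show ?thesis .
  qed
qed

section \<open>Calculus on the Bernoulli cube\<close>

definition bern_exp :: "'a set \<Rightarrow> real \<Rightarrow> (('a \<Rightarrow> bool) \<Rightarrow> real) \<Rightarrow> real" where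
  "bern_exp I p \<phi> = measure_pmf.expectation (Pi_pmf I False (\<lambda>_. bernoulli_pmf p)) \<phi>"

lemma bern_exp_cong: "I = J \<Longrightarrow> p = q \<Longrightarrow> (\<And>X. \<phi> X = \<psi> X) \<Longrightarrow> bern_exp I p \<phi> = bern_exp J q \<psi>"
  by (metis ext)

text \<open>The conditional expectation given all coordinates other than \<open>e\<close>.\<close>

definition coord_avg :: "real \<Rightarrow> 'a \<Rightarrow> (('a \<Rightarrow> bool) \<Rightarrow> real) \<Rightarrow> ('a \<Rightarrow> bool) \<Rightarrow> real" where
  "coord_avg p e \<phi> X = p * \<phi> (X(e := True)) + (1 - p) * \<phi> (X(e := False))"

definition coord_diff :: "'a \<Rightarrow> (('a \<Rightarrow> bool) \<Rightarrow> real) \<Rightarrow> ('a \<Rightarrow> bool) \<Rightarrow> real" where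
  "coord_diff e \<phi> X = \<phi> (X(e := True)) - \<phi> (X(e := False))"

definition ignores :: "(('a \<Rightarrow> bool) \<Rightarrow> 'b) \<Rightarrow> 'a \<Rightarrow> bool" where
  "ignores \<phi> e \<longleftrightarrow> (\<forall>X b. \<phi> (X(e := b)) = \<phi> X)"

lemma ignoresD: "ignores \<phi> e \<Longrightarrow> \<phi> (X(e := b)) = \<phi> X"
  by (simp add: ignores_def)

lemma ignores_coord_diff [simp]: "ignores (coord_diff e \<phi>) e"
  by (simp add: ignores_def coord_diff_def)

lemma ignores_coord_diff_other: "ignores \<phi> f \<Longrightarrow> ignores (coord_diff e \<phi>) f"
  by (cases "e = f") (simp_all add: ignores_def coord_diff_def fun_upd_twist)

lemma coord_avg_ignores: "ignores \<phi> e \<Longrightarrow> coord_avg p e \<phi> X = \<phi> X"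
  by (simp add: coord_avg_def ignoresD algebra_simps)

lemma coord_avg_mult: "ignores \<phi> e \<Longrightarrow> coord_avg p e (\<lambda>X. \<phi> X * \<psi> X) X = \<phi> X * coord_avg p e \<psi> X"
  by (simp add: coord_avg_def ignoresD algebra_simps)

lemma coord_diff_avg:
  "e \<noteq> f \<Longrightarrow> coord_diff f (coord_avg p e \<phi>) X = coord_avg p e (coord_diff f \<phi>) X"
  by (simp add: coord_diff_def coord_avg_def fun_upd_twist algebra_simps)

lemma ignores_coord_avg: "ignores \<phi> f \<Longrightarrow> ignores (coord_avg p e \<phi>) f"
  by (cases "e = f") (simp_all add: ignores_def coord_avg_def fun_upd_twist)

lemma convex_square:
  assumes "0 \<le> p" "p \<le> (1::real)"
  shows "(p * a + (1 - p) * b)\<^sup>2 \<le> p * a\<^sup>2 + (1 - p) * b\<^sup>2"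
proof -
  have "p * a\<^sup>2 + (1 - p) * b\<^sup>2 - (p * a + (1 - p) * b)\<^sup>2 = p * (1 - p) * (a - b)\<^sup>2"
    by (simp add: power2_eq_square algebra_simps)
  also have "\<dots> \<ge> 0" using assms by simp
  finally show ?thesis by simp
qed

locale bernoulli_cube =
  fixes I :: "'a set" and p :: real
  assumes finite_I: "finite I" and p_nonneg: "0 \<le> p" and p_le_1: "p \<le> 1"
begin

abbreviation E :: "(('a \<Rightarrow> bool) \<Rightarrow> real) \<Rightarrow> real" where
  "E \<equiv> bern_exp I p"

lemma finite_set_pmf: "finite (set_pmf (Pi_pmf I False (\<lambda>_. bernoulli_pmf p)))"
proof -
  have "finite (PiE_dflt I False (\<lambda>_. UNIV :: bool set))"
    by (intro finite_PiE_dflt finite_I) auto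
  moreover have "set_pmf (Pi_pmf I False (\<lambda>_. bernoulli_pmf p)) \<subseteq> PiE_dflt I False (\<lambda>_. UNIV)"
    using set_Pi_pmf_subset[OF finite_I] by (fastforce simp: PiE_dflt_def)
  ultimately show "finite (set_pmf (Pi_pmf I False (\<lambda>_. bernoulli_pmf p)))"
    by (rule rev_finite_subset)
qed

lemma integrable_Pi_bernoulli [simp]:
  fixes \<phi> :: "('a \<Rightarrow> bool) \<Rightarrow> real"
  shows "integrable (measure_pmf (Pi_pmf I False (\<lambda>_. bernoulli_pmf p))) \<phi>"
  by (rule integrable_measure_pmf_finite) (rule finite_set_pmf)

lemma E_add: "E (\<lambda>X. \<phi> X + \<psi> X) = E \<phi> + E \<psi>"
  by (simp add: bern_exp_def)

lemma E_diff: "E (\<lambda>X. \<phi> X - \<psi> X) = E \<phi> - E \<psi>"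
  by (simp add: bern_exp_def)

lemma E_cmult: "E (\<lambda>X. c * \<phi> X) = c * E \<phi>"
  by (simp add: bern_exp_def)

lemma E_sum: "E (\<lambda>X. \<Sum>a\<in>A. \<phi> a X) = (\<Sum>a\<in>A. E (\<phi> a))"
  by (simp add: bern_exp_def)

lemma E_const [simp]: "E (\<lambda>X. c) = c"
  by (simp add: bern_exp_def)

lemma E_mono: "(\<And>X. \<phi> X \<le> \<psi> X) \<Longrightarrow> E \<phi> \<le> E \<psi>"
  unfolding bern_exp_def by (intro integral_mono) auto

lemma E_nonneg: "(\<And>X. 0 \<le> \<phi> X) \<Longrightarrow> 0 \<le> E \<phi>"
  using E_mono[of "\<lambda>_. 0" \<phi>] by simp

lemma E_abs: "\<bar>E \<phi>\<bar> \<le> E (\<lambda>X. \<bar>\<phi> X\<bar>)"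
  unfolding bern_exp_def by (rule integral_abs_bound)

lemma E_variance: "E (\<lambda>X. (\<phi> X - E \<phi>)\<^sup>2) = E (\<lambda>X. (\<phi> X)\<^sup>2) - (E \<phi>)\<^sup>2"
proof -
  have "(\<lambda>X. (\<phi> X - E \<phi>)\<^sup>2) = (\<lambda>X. (\<phi> X)\<^sup>2 - (2 * E \<phi>) * \<phi> X + (E \<phi>)\<^sup>2)"
    by (simp add: power2_diff fun_eq_iff)
  then show ?thesis by (simp only: E_add E_diff E_cmult E_const) (simp add: power2_eq_square)
qed

lemma E_abs_le_sqrt: "E (\<lambda>X. \<bar>\<phi> X\<bar>) \<le> sqrt (E (\<lambda>X. (\<phi> X)\<^sup>2))"
proof (rule real_le_rsqrt)
  have "0 \<le> E (\<lambda>X. (\<bar>\<phi> X\<bar> - E (\<lambda>X. \<bar>\<phi> X\<bar>))\<^sup>2)" by (rule E_nonneg) simp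
  then show "(E (\<lambda>X. \<bar>\<phi> X\<bar>))\<^sup>2 \<le> E (\<lambda>X. (\<phi> X)\<^sup>2)" by (simp add: E_variance)
qed

end

lemma bern_exp_empty: "bern_exp {} p \<phi> = \<phi> (\<lambda>_. False)"
  by (simp add: bern_exp_def)

text \<open>Fubini in one coordinate, the step of every induction on the cube.\<close>

lemma bern_exp_insert:
  assumes "finite I" "e \<notin> I" "0 \<le> p" "p \<le> 1"
  shows "bern_exp (insert e I) p \<phi> = bern_exp I p (coord_avg p e \<phi>)"
proof -
  interpret bernoulli_cube I p using assms by unfold_locales
  let ?P = "Pi_pmf I False (\<lambda>_. bernoulli_pmf p)"
  have "Pi_pmf (insert e I) False (\<lambda>_. bernoulli_pmf p) =
      bind_pmf (bernoulli_pmf p) (\<lambda>b. map_pmf (\<lambda>X. X(e := b)) ?P)"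
    using assms by (simp add: Pi_pmf_insert pair_pmf_def map_bind_pmf map_pmf_def bind_assoc_pmf bind_return_pmf)
  moreover have "finite (set_pmf (map_pmf (\<lambda>X. X(e := b)) ?P))" for b
    by (simp add: finite_set_pmf)
  ultimately have "bern_exp (insert e I) p \<phi> =
      (\<Sum>b\<in>UNIV. pmf (bernoulli_pmf p) b * measure_pmf.expectation (map_pmf (\<lambda>X. X(e := b)) ?P) \<phi>)"
    unfolding bern_exp_def by (simp add: pmf_expectation_bind[where A = UNIV] del: integral_map_pmf)
  also have "\<dots> = p * E (\<lambda>X. \<phi> (X(e := True))) + (1 - p) * E (\<lambda>X. \<phi> (X(e := False)))"
    using assms by (simp add: bern_exp_def UNIV_bool)
  also have "\<dots> = E (coord_avg p e \<phi>)"
    unfolding coord_avg_def by (simp add: E_add E_cmult)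
  finally show ?thesis .
qed

section \<open>Integration by parts, independence and the Poincare inequality\<close>

context bernoulli_cube
begin

lemma E_coord_avg:
  assumes "e \<in> I"
  shows "E (coord_avg p e \<phi>) = E \<phi>"
proof -
  have I: "I = insert e (I - {e})" "finite (I - {e})" using assms finite_I by auto
  have "bern_exp (insert e (I - {e})) p (coord_avg p e \<phi>) = bern_exp (insert e (I - {e})) p \<phi>"
    using I(2) p_nonneg p_le_1
    by (simp only: bern_exp_insert Diff_iff singletonI not_True_eq_False simp_thms)
       (simp add: coord_avg_def[abs_def] algebra_simps)
  then show ?thesis using I(1) by simp
qed

text \<open>Averaged over \<open>e\<close>, the centred indicator takes the values
  \<open>1 - p\<close> and \<open>- p\<close> with weights \<open>p\<close> and
  \<open>1 - p\<close>, so only \<open>p * (1 - p)\<close> times the difference of the two values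
  survives.\<close>

lemma E_ibp:
  assumes "e \<in> I" "ignores u e"
  shows "E (\<lambda>X. (of_bool (X e) - p) * u X * \<phi> X) = p * (1 - p) * E (\<lambda>X. u X * coord_diff e \<phi> X)"
proof -
  have "coord_avg p e (\<lambda>X. (of_bool (X e) - p) * u X * \<phi> X) X = p * (1 - p) * (u X * coord_diff e \<phi> X)" for X
    by (simp add: coord_avg_def coord_diff_def ignoresD[OF assms(2)] algebra_simps)
  then show ?thesis
    by (subst E_coord_avg[OF assms(1), symmetric]) (simp add: E_cmult[symmetric] cong: bern_exp_cong)
qed

text \<open>Independence expressed through the coordinates: in each one at least one factor is
  constant and comes out of the average.\<close>

lemma E_mult_indep:
  assumes "\<And>e. e \<in> I \<Longrightarrow> ignores \<phi> e \<or> ignores \<psi> e"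
  shows "E (\<lambda>X. \<phi> X * \<psi> X) = E \<phi> * E \<psi>"
  using finite_I assms
proof (induction I arbitrary: \<phi> \<psi> rule: finite_induct)
  case empty
  then show ?case by (simp add: bern_exp_empty)
next
  case (insert e J)
  note ins = bern_exp_insert[OF insert.hyps p_nonneg p_le_1]
  have "coord_avg p e (\<lambda>X. \<phi> X * \<psi> X) X = coord_avg p e \<phi> X * coord_avg p e \<psi> X" for X
  proof (cases "ignores \<phi> e")
    case True
    then show ?thesis by (simp add: coord_avg_mult coord_avg_ignores)
  next
    case False
    then have "ignores \<psi> e" using insert.prems by blast
    then show ?thesis
      using coord_avg_mult[of \<psi> e p \<phi> X] by (simp add: mult.commute coord_avg_ignores)
  qed
  moreover have "bern_exp J p (\<lambda>X. coord_avg p e \<phi> X * coord_avg p e \<psi> X) =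
      bern_exp J p (coord_avg p e \<phi>) * bern_exp J p (coord_avg p e \<psi>)"
    using insert.prems by (intro insert.IH) (auto intro: ignores_coord_avg)
  ultimately show ?case by (simp add: ins cong: bern_exp_cong)
qed

text \<open>Averaging out one coordinate splits off exactly its own term of the sum. The average
  commutes with the other differences, and by convexity of the square it can only decrease
  them.\<close>

lemma poincare:
  "E (\<lambda>X. (\<phi> X - E \<phi>)\<^sup>2) \<le> (\<Sum>e\<in>I. p * (1 - p) * E (\<lambda>X. (coord_diff e \<phi> X)\<^sup>2))"
proof -
  have "E (\<lambda>X. (\<phi> X)\<^sup>2) - (E \<phi>)\<^sup>2 \<le> (\<Sum>e\<in>I. p * (1 - p) * E (\<lambda>X. (coord_diff e \<phi> X)\<^sup>2))"
    using finite_I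
  proof (induction I arbitrary: \<phi> rule: finite_induct)
    case empty
    then show ?case by (simp add: bern_exp_empty)
  next
    case (insert e J)
    interpret J: bernoulli_cube J p using insert.hyps p_nonneg p_le_1 by unfold_locales
    note ins = bern_exp_insert[OF insert.hyps p_nonneg p_le_1]
    let ?\<psi> = "coord_avg p e \<phi>"
    have "coord_avg p e (\<lambda>X. (\<phi> X)\<^sup>2) X = (?\<psi> X)\<^sup>2 + p * (1 - p) * (coord_diff e \<phi> X)\<^sup>2" for X
      by (simp add: coord_avg_def coord_diff_def power2_eq_square algebra_simps)
    then have "bern_exp (insert e J) p (\<lambda>X. (\<phi> X)\<^sup>2) - (bern_exp (insert e J) p \<phi>)\<^sup>2 =
        (J.E (\<lambda>X. (?\<psi> X)\<^sup>2) - (J.E ?\<psi>)\<^sup>2) + p * (1 - p) * J.E (\<lambda>X. (coord_diff e \<phi> X)\<^sup>2)"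
      by (simp add: ins J.E_add J.E_cmult cong: bern_exp_cong)
    also have "J.E (\<lambda>X. (coord_diff e \<phi> X)\<^sup>2) = bern_exp (insert e J) p (\<lambda>X. (coord_diff e \<phi> X)\<^sup>2)"
      by (simp add: ins coord_avg_ignores ignores_def coord_diff_def cong: bern_exp_cong)
    also have "J.E (\<lambda>X. (?\<psi> X)\<^sup>2) - (J.E ?\<psi>)\<^sup>2 \<le>
        (\<Sum>f\<in>J. p * (1 - p) * J.E (\<lambda>X. (coord_diff f ?\<psi> X)\<^sup>2))"
      by (rule insert.IH)
    also have "\<dots> \<le> (\<Sum>f\<in>J. p * (1 - p) * bern_exp (insert e J) p (\<lambda>X. (coord_diff f \<phi> X)\<^sup>2))"
    proof (intro sum_mono mult_left_mono)
      fix f assume "f \<in> J"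
      then have "e \<noteq> f" using insert.hyps by auto
      show "J.E (\<lambda>X. (coord_diff f ?\<psi> X)\<^sup>2) \<le> bern_exp (insert e J) p (\<lambda>X. (coord_diff f \<phi> X)\<^sup>2)"
        unfolding ins coord_diff_avg[OF \<open>e \<noteq> f\<close>]
        by (rule J.E_mono) (simp add: coord_avg_def convex_square p_nonneg p_le_1)
    qed (use p_nonneg p_le_1 in auto)
    finally show ?case using insert.hyps by simp
  qed
  then show ?thesis by (simp add: E_variance)
qed

text \<open>A discrete Skorokhod isometry. Two integrations by parts turn a mixed term into mixed
  differences, so it vanishes as soon as one of \<open>u e\<close>, \<open>u f\<close> ignores the
  coordinate of the other.\<close>

lemma divergence_isometry:
  assumes u: "\<And>e. e \<in> I \<Longrightarrow> ignores (u e) e"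
  shows "E (\<lambda>X. (\<Sum>e\<in>I. (of_bool (X e) - p) * u e X)\<^sup>2) =
    (\<Sum>e\<in>I. p * (1 - p) * E (\<lambda>X. (u e X)\<^sup>2)) +
    (\<Sum>e\<in>I. \<Sum>f\<in>I - {e}. (p * (1 - p))\<^sup>2 * E (\<lambda>X. coord_diff f (u e) X * coord_diff e (u f) X))"
proof -
  let ?R = "\<lambda>e X. (of_bool (X e) - p) * u e X"
  have diag: "E (\<lambda>X. ?R e X * ?R e X) = p * (1 - p) * E (\<lambda>X. (u e X)\<^sup>2)" if "e \<in> I" for e
  proof -
    have "coord_diff e (?R e) X = u e X" for X
      using ignoresD[OF u[OF that]] by (simp add: coord_diff_def algebra_simps)
    then show ?thesis using E_ibp[OF that u[OF that], of "?R e"] by (simp add: power2_eq_square cong: bern_exp_cong)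
  qed
  have off: "E (\<lambda>X. ?R e X * ?R f X) =
      (p * (1 - p))\<^sup>2 * E (\<lambda>X. coord_diff f (u e) X * coord_diff e (u f) X)"
    if "e \<in> I" "f \<in> I" "f \<noteq> e" for e f
  proof -
    have "coord_diff e (?R f) X = (of_bool (X f) - p) * coord_diff e (u f) X" for X
      using that by (simp add: coord_diff_def algebra_simps)
    then have "E (\<lambda>X. ?R e X * ?R f X) =
        p * (1 - p) * E (\<lambda>X. u e X * ((of_bool (X f) - p) * coord_diff e (u f) X))"
      using E_ibp[OF that(1) u[OF that(1)], of "?R f"] by (simp cong: bern_exp_cong)
    also have "(\<lambda>X. u e X * ((of_bool (X f) - p) * coord_diff e (u f) X)) =
        (\<lambda>X. (of_bool (X f) - p) * coord_diff e (u f) X * u e X)"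
      by (simp add: mult_ac)
    also have "E \<dots> = p * (1 - p) * E (\<lambda>X. coord_diff e (u f) X * coord_diff f (u e) X)"
      using that u by (intro E_ibp ignores_coord_diff_other) auto
    finally show ?thesis by (simp add: power2_eq_square mult_ac)
  qed
  have "E (\<lambda>X. (\<Sum>e\<in>I. ?R e X)\<^sup>2) = (\<Sum>e\<in>I. \<Sum>f\<in>I. E (\<lambda>X. ?R e X * ?R f X))"
    by (simp add: power2_eq_square sum_product E_sum)
  also have "\<dots> = (\<Sum>e\<in>I. E (\<lambda>X. ?R e X * ?R e X) + (\<Sum>f\<in>I - {e}. E (\<lambda>X. ?R e X * ?R f X)))"
    by (intro sum.cong refl) (simp add: sum.remove[OF finite_I])
  also have "\<dots> = (\<Sum>e\<in>I. p * (1 - p) * E (\<lambda>X. (u e X)\<^sup>2) +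
      (\<Sum>f\<in>I - {e}. (p * (1 - p))\<^sup>2 * E (\<lambda>X. coord_diff f (u e) X * coord_diff e (u f) X)))"
    by (intro sum.cong arg_cong2[where f = "(+)"] refl diag off) auto
  finally show ?thesis by (simp add: sum.distrib)
qed

text \<open>Comparing \<open>f (W)\<close> at the two ends of an edge with \<open>stein_rhs\<close> leaves an error that is
  itself a coordinate difference of the monotone function \<open>stein_mono\<close>, so a second
  integration by parts turns it into the expectation of a centred sum.\<close>

theorem stein_bernoulli:
  fixes h Y :: "('a \<Rightarrow> bool) \<Rightarrow> real"
  assumes poisson: "\<And>X. (\<Sum>e\<in>I. (of_bool (X e) - p) * coord_diff e h X) = Y X - E Y"
    and s2: "s2 = E (\<lambda>X. (Y X - E Y)\<^sup>2)" "0 < s2"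
  defines "T \<equiv> \<lambda>X. \<Sum>e\<in>I. p * (1 - p) * (coord_diff e h X * coord_diff e Y X)"
    and "R \<equiv> \<lambda>X. \<Sum>e\<in>I. (of_bool (X e) - p) * (\<bar>coord_diff e h X\<bar> * coord_diff e Y X)"
  shows "E T = s2"
    and "\<bar>E (\<lambda>X. of_bool ((Y X - E Y) / sqrt s2 \<le> z)) - Phi z\<bar>
           \<le> 2 / s2 * (E (\<lambda>X. \<bar>T X - s2\<bar>) + E (\<lambda>X. \<bar>R X\<bar>))"
proof -
  have ibp: "E (\<lambda>X. (Y X - E Y) * \<phi> X) = E (\<lambda>X. \<Sum>e\<in>I. p * (1 - p) * (coord_diff e h X * coord_diff e \<phi> X))"
    for \<phi>
  proof -
    have "E (\<lambda>X. (Y X - E Y) * \<phi> X) = (\<Sum>e\<in>I. E (\<lambda>X. (of_bool (X e) - p) * coord_diff e h X * \<phi> X))"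
      by (simp add: poisson[symmetric] sum_distrib_right E_sum)
    also have "\<dots> = (\<Sum>e\<in>I. p * (1 - p) * E (\<lambda>X. coord_diff e h X * coord_diff e \<phi> X))"
      by (intro sum.cong refl E_ibp) auto
    finally show ?thesis by (simp add: E_sum E_cmult)
  qed
  show "E T = s2"
  proof -
    have "s2 = E (\<lambda>X. (Y X - E Y) * (Y X - E Y))" by (simp add: s2 power2_eq_square)
    also have "\<dots> = E T" by (subst ibp) (simp add: T_def coord_diff_def)
    finally show ?thesis by simp
  qed
  define s where "s = sqrt s2"
  have s: "0 < s" "s * s = s2" using s2 by (simp_all add: s_def)
  define W where "W = (\<lambda>X. (Y X - E Y) / s)"
  define f where "f = stein_sol z"
  define G where "G = (\<lambda>X. stein_mono z (W X))"
  have dW: "coord_diff e Y X = s * coord_diff e W X" for e X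
    using s by (simp add: W_def coord_diff_def field_simps)
  let ?D = "\<lambda>e X. coord_diff e h X * (coord_diff e (\<lambda>X. f (W X)) X - coord_diff e W X * stein_rhs z (W X))"
  let ?B = "\<lambda>e X. \<bar>coord_diff e h X\<bar> * coord_diff e Y X * coord_diff e G X"
  have err: "\<bar>?D e X\<bar> \<le> ?B e X / s" for e X
  proof -
    \<comment> \<open>One end of the flip is the current configuration, so \<open>stein_rhs\<close>
      can be evaluated at \<open>W X\<close> itself for all \<open>e\<close> at once; this lets it
      factor out of the sum and leaves \<open>T\<close>.\<close>
    have "W X = W (X(e := False)) \<or> W X = W (X(e := True))"
      by (cases "X e") (simp_all add: fun_upd_idem)
    from stein_sol_increment[OF this, of z]
    have "\<bar>coord_diff e (\<lambda>X. f (W X)) X - coord_diff e W X * stein_rhs z (W X)\<bar> \<le> coord_diff e W X * coord_diff e G X"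
      by (simp add: coord_diff_def f_def G_def)
    then have "\<bar>?D e X\<bar> \<le> \<bar>coord_diff e h X\<bar> * (coord_diff e W X * coord_diff e G X)"
      unfolding abs_mult by (rule mult_left_mono) simp
    also have "\<dots> = ?B e X / s"
      using s by (simp add: dW)
    finally show ?thesis .
  qed
  have "E (\<lambda>X. of_bool ((Y X - E Y) / sqrt s2 \<le> z)) - Phi z = E (\<lambda>X. of_bool (W X \<le> z) - Phi z)"
    by (simp add: E_diff W_def s_def)
  also have "\<dots> = E (\<lambda>X. stein_rhs z (W X) - W X * f (W X))"
    by (simp add: stein_rhs_def f_def)
  also have "\<dots> = E (\<lambda>X. stein_rhs z (W X)) - E (\<lambda>X. (Y X - E Y) * f (W X)) / s"
    using s by (simp add: E_diff W_def E_cmult[of "1 / s", symmetric, simplified])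
  also have "E (\<lambda>X. (Y X - E Y) * f (W X)) =
      E (\<lambda>X. \<Sum>e\<in>I. p * (1 - p) * (coord_diff e h X * coord_diff e (\<lambda>X. f (W X)) X))"
    by (rule ibp)
  also have "\<dots> = E (\<lambda>X. \<Sum>e\<in>I. p * (1 - p) * ?D e X) + E (\<lambda>X. T X * stein_rhs z (W X)) / s"
  proof -
    have "(\<Sum>e\<in>I. p * (1 - p) * (coord_diff e h X * coord_diff e (\<lambda>X. f (W X)) X)) =
        (\<Sum>e\<in>I. p * (1 - p) * ?D e X) + 1 / s * (T X * stein_rhs z (W X))" for X
      using s unfolding T_def sum_distrib_right sum_distrib_left sum.distrib[symmetric]
      by (intro sum.cong refl) (simp add: dW algebra_simps)
    then show ?thesis
      by (simp only: E_add E_cmult) simp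
  qed
  also have "E (\<lambda>X. stein_rhs z (W X)) - (E (\<lambda>X. \<Sum>e\<in>I. p * (1 - p) * ?D e X) + E (\<lambda>X. T X * stein_rhs z (W X)) / s) / s =
      (s2 * E (\<lambda>X. stein_rhs z (W X)) - E (\<lambda>X. T X * stein_rhs z (W X))) / s2 - E (\<lambda>X. \<Sum>e\<in>I. p * (1 - p) * ?D e X) / s"
    (is "?rh - (?DD + ?TT / s) / s = (s2 * ?rh - ?TT) / s2 - ?DD / s")
  proof -
    have "r - (a + b / s) / s = (s2 * r - b) / s2 - a / s" for r a b
      using s(1) by (simp add: s(2)[symmetric] field_simps)
    then show ?thesis .
  qed
  finally have main: "E (\<lambda>X. of_bool ((Y X - E Y) / sqrt s2 \<le> z)) - Phi z =
      E (\<lambda>X. (s2 - T X) * stein_rhs z (W X)) / s2 - E (\<lambda>X. \<Sum>e\<in>I. p * (1 - p) * ?D e X) / s"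
    by (simp only: left_diff_distrib E_diff E_cmult)
  have A: "\<bar>E (\<lambda>X. (s2 - T X) * stein_rhs z (W X))\<bar> \<le> 2 * E (\<lambda>X. \<bar>T X - s2\<bar>)"
  proof -
    have "\<bar>(s2 - T X) * stein_rhs z (W X)\<bar> \<le> 2 * \<bar>T X - s2\<bar>" for X
      using mult_left_mono[OF stein_rhs_bound[of z "W X"], of "\<bar>T X - s2\<bar>"]
      by (simp add: abs_mult abs_minus_commute)
    then have "E (\<lambda>X. \<bar>(s2 - T X) * stein_rhs z (W X)\<bar>) \<le> E (\<lambda>X. 2 * \<bar>T X - s2\<bar>)"
      by (rule E_mono)
    with E_abs show ?thesis unfolding E_cmult by (rule order_trans)
  qed
  have B: "\<bar>E (\<lambda>X. \<Sum>e\<in>I. p * (1 - p) * ?D e X)\<bar> \<le> 2 * E (\<lambda>X. \<bar>R X\<bar>) / s"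
  proof -
    have "\<bar>\<Sum>e\<in>I. p * (1 - p) * ?D e X\<bar> \<le> (\<Sum>e\<in>I. p * (1 - p) * (?B e X / s))" for X
    proof (rule order_trans[OF sum_abs sum_mono])
      fix e
      show "\<bar>p * (1 - p) * ?D e X\<bar> \<le> p * (1 - p) * (?B e X / s)"
        using mult_left_mono[OF err[of e X], of "p * (1 - p)"] p_nonneg p_le_1
        by (simp add: abs_mult mult_ac)
    qed
    then have "\<bar>E (\<lambda>X. \<Sum>e\<in>I. p * (1 - p) * ?D e X)\<bar> \<le> E (\<lambda>X. \<Sum>e\<in>I. p * (1 - p) * (?B e X / s))"
      by (intro order_trans[OF E_abs] E_mono)
    also have "\<dots> = (\<Sum>e\<in>I. p * (1 - p) * E (\<lambda>X. (\<bar>coord_diff e h X\<bar> * coord_diff e Y X) * coord_diff e G X)) / s"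
    proof -
      have scale: "(\<lambda>X. p * (1 - p) * (?B e X / s)) = (\<lambda>X. p * (1 - p) / s * ?B e X)" for e by simp
      show ?thesis
        unfolding E_sum sum_divide_distrib scale E_cmult by simp
    qed
    \<comment> \<open>The weight ignores its own coordinate, so integration by parts can be read
      from right to left; afterwards only the boundedness of \<open>G\<close> matters.\<close>
    also have "(\<Sum>e\<in>I. p * (1 - p) * E (\<lambda>X. (\<bar>coord_diff e h X\<bar> * coord_diff e Y X) * coord_diff e G X)) =
        (\<Sum>e\<in>I. E (\<lambda>X. (of_bool (X e) - p) * (\<bar>coord_diff e h X\<bar> * coord_diff e Y X) * G X))"
    proof (intro sum.cong refl E_ibp[symmetric])
      show "ignores (\<lambda>X. \<bar>coord_diff e h X\<bar> * coord_diff e Y X) e" for e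
        by (simp add: ignores_def coord_diff_def)
    qed
    also have "\<dots> = E (\<lambda>X. R X * G X)"
      by (simp add: R_def sum_distrib_right E_sum)
    also have "\<dots> \<le> E (\<lambda>X. 2 * \<bar>R X\<bar>)"
    proof (rule E_mono)
      fix X
      show "R X * G X \<le> 2 * \<bar>R X\<bar>"
        using mult_left_mono[OF stein_mono_bound[of z "W X"], of "\<bar>R X\<bar>"]
        unfolding G_def abs_mult[symmetric] by linarith
    qed
    finally show ?thesis using s by (simp add: E_cmult divide_right_mono)
  qed
  have "\<bar>a / s2 - b / s\<bar> \<le> 2 / s2 * (x + y)" if "\<bar>a\<bar> \<le> 2 * x" "\<bar>b\<bar> \<le> 2 * y / s" for a b x y
  proof -
    have "\<bar>a / s2\<bar> \<le> 2 * x / s2"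
      using divide_right_mono[OF that(1), of s2] s2(2) by (simp add: abs_divide)
    moreover have "\<bar>b / s\<bar> \<le> 2 * y / s2"
      using divide_right_mono[OF that(2), of s] s(1) by (simp add: abs_divide s(2)[symmetric])
    ultimately have "\<bar>a / s2 - b / s\<bar> \<le> 2 * x / s2 + 2 * y / s2" by linarith
    then show ?thesis by (simp add: distrib_left add_divide_distrib)
  qed
  from this[OF A B] show "\<bar>E (\<lambda>X. of_bool ((Y X - E Y) / sqrt s2 \<le> z)) - Phi z\<bar>
           \<le> 2 / s2 * (E (\<lambda>X. \<bar>T X - s2\<bar>) + E (\<lambda>X. \<bar>R X\<bar>))"
    unfolding main .
qed

end

section \<open>The Poisson equation for binomial counts\<close>

definition binom_prob :: "nat \<Rightarrow> real \<Rightarrow> nat \<Rightarrow> real" where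
  "binom_prob m p k = real (m choose k) * p ^ k * (1 - p) ^ (m - k)"

lemma binom_prob_nonneg: "0 \<le> p \<Longrightarrow> p \<le> 1 \<Longrightarrow> 0 \<le> binom_prob m p k"
  by (simp add: binom_prob_def)

lemma sum_binom_prob: "(\<Sum>k\<le>m. binom_prob m p k) = 1"
  using binomial_ring[of p "1 - p" m] by (simp add: binom_prob_def)

lemma Suc_times_choose_Suc: "real (m choose Suc k) * real (Suc k) = real (m choose k) * (real m - real k)"
proof (cases "k \<le> m")
  case True
  have "Suc k * (m choose Suc k) = (m - k) * (m choose k)"
    by (simp only: binomial_absorption binomial_absorb_comp)
  then have "real (Suc k * (m choose Suc k)) = real ((m - k) * (m choose k))" by simp
  then show ?thesis using True by (simp only: of_nat_mult of_nat_diff) (simp add: mult_ac)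
qed (simp add: binomial_eq_0)

text \<open>Detailed balance for the chain with birth rate \<open>(m - k) * p\<close> and death rate
  \<open>k * (1 - p)\<close>.\<close>

lemma binom_prob_Suc:
  assumes "k < m"
  shows "binom_prob m p (Suc k) * (real (Suc k) * (1 - p)) = binom_prob m p k * ((real m - real k) * p)"
proof -
  have "(1 - p) ^ (m - k) = (1 - p) * (1 - p) ^ (m - Suc k)"
    using assms by (simp add: Suc_diff_Suc flip: power_Suc)
  then have "binom_prob m p (Suc k) * (real (Suc k) * (1 - p)) =
      (real (m choose Suc k) * real (Suc k)) * p ^ Suc k * (1 - p) ^ (m - k)"
    by (simp add: binom_prob_def)
  also have "\<dots> = binom_prob m p k * ((real m - real k) * p)"
    by (simp only: Suc_times_choose_Suc) (simp add: binom_prob_def)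
  finally show ?thesis .
qed

text \<open>The union bound over \<open>k\<close>-subsets, done on coefficients: choosing a
  \<open>k\<close>-subset inside the chosen set bounds the tail by a multiple of the total mass of
  the binomial law on \<open>m - k\<close> trials.\<close>

lemma binom_prob_tail_le:
  assumes "0 \<le> p" "p \<le> 1" "k \<le> m"
  shows "(\<Sum>j=k..m. binom_prob m p j) \<le> real (m choose k) * p ^ k"
proof -
  have "(\<Sum>j=k..m. binom_prob m p j) = (\<Sum>i\<le>m - k. binom_prob m p (i + k))"
    using assms(3) sum.shift_bounds_cl_nat_ivl[of "binom_prob m p" 0 k "m - k"]
    by (simp add: atMost_atLeast0)
  also have "\<dots> \<le> (\<Sum>i\<le>m - k. real (m choose k) * p ^ k * binom_prob (m - k) p i)"
  proof (rule sum_mono)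
    fix i assume "i \<in> {..m - k}"
    then have i: "i + k \<le> m" using assms(3) by simp
    have "(m choose (i + k)) * 1 \<le> (m choose (i + k)) * ((i + k) choose k)"
      by (rule mult_le_mono) (simp_all add: Suc_leI)
    also have "\<dots> = (m choose k) * ((m - k) choose i)"
      using choose_mult[of k "i + k" m] i by simp
    finally have "real (m choose (i + k)) \<le> real ((m choose k) * ((m - k) choose i))"
      by (simp only: of_nat_le_iff mult_1_right)
    then have "real (m choose (i + k)) * (p ^ (i + k) * (1 - p) ^ (m - (i + k)))
        \<le> real ((m choose k) * ((m - k) choose i)) * (p ^ (i + k) * (1 - p) ^ (m - (i + k)))"
      using assms by (intro mult_right_mono) auto
    then show "binom_prob m p (i + k) \<le> real (m choose k) * p ^ k * binom_prob (m - k) p i"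
      by (simp add: binom_prob_def power_add mult_ac add.commute)
  qed
  also have "\<dots> = real (m choose k) * p ^ k"
    by (simp add: sum_distrib_left[symmetric] sum_binom_prob)
  finally show ?thesis .
qed

text \<open>The increments of the solution of the Poisson equation of the binomial birth and death chain
  whose right-hand side is the centred indicator of \<open>d\<close>. At \<open>k = m\<close> the division by zero gives the
  value \<open>0\<close>, which is harmless because there is no further birth.\<close>

definition binom_step :: "nat \<Rightarrow> nat \<Rightarrow> real \<Rightarrow> nat \<Rightarrow> real" where
  "binom_step d m p k = binom_prob m p d * ((\<Sum>j\<le>k. binom_prob m p j) - of_bool (d \<le> k))
     / (binom_prob m p k * ((real m - real k) * p))"

text \<open>After multiplication by the mass at \<open>k\<close>, detailed balance makes both terms
  consecutive values of the partial sums \<open>?a\<close>, and their difference is the centred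
  indicator.\<close>

lemma binom_step_eq:
  assumes p: "0 < p" "p < 1" and "d \<le> m" "k \<le> m"
  shows "real k * (1 - p) * binom_step d m p (k - 1) - (real m - real k) * p * binom_step d m p k =
    of_bool (k = d) - binom_prob m p d"
proof -
  let ?a = "\<lambda>k. binom_prob m p d * ((\<Sum>j\<le>k. binom_prob m p j) - of_bool (d \<le> k))"
  have pos: "0 < binom_prob m p k" if "k \<le> m" for k
    using that p by (simp add: binom_prob_def)
  have birth: "binom_prob m p k * ((real m - real k) * p) * binom_step d m p k = ?a k" if "k \<le> m" for k
  proof (cases "k = m")
    \<comment> \<open>Both sides vanish: the birth rate is 0, and the masses up to \<open>m\<close>
      sum to 1.\<close>
    case True
    then show ?thesis using \<open>d \<le> m\<close> by (simp add: sum_binom_prob)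
  next
    case False
    then show ?thesis using pos[OF that] that p by (simp add: binom_step_def)
  qed
  have "binom_prob m p k * (real k * (1 - p) * binom_step d m p (k - 1) - (real m - real k) * p * binom_step d m p k)
     = binom_prob m p k * (of_bool (k = d) - binom_prob m p d)"
  proof (cases k)
    \<comment> \<open>Here \<open>k - 1\<close> truncates to 0, but the death rate multiplying that
      value is 0.\<close>
    case 0
    have "binom_prob m p 0 * (real m * p * binom_step d m p 0) =
        binom_prob m p 0 * (binom_prob m p d - of_bool (d = 0))"
      using birth[of 0] by (cases "d = 0") (simp_all add: mult_ac)
    then have "real m * p * binom_step d m p 0 = binom_prob m p d - of_bool (d = 0)"
      using pos[of 0] by simp
    moreover have "(0 = d) = (d = 0)" by auto
    ultimately show ?thesis using 0 by simp
  next
    case (Suc j)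
    have death: "binom_prob m p k * (real k * (1 - p)) * binom_step d m p j = ?a j"
      using birth[of j] Suc \<open>k \<le> m\<close> binom_prob_Suc[of j m p] by simp
    have "binom_prob m p k * (real k * (1 - p) * binom_step d m p (k - 1) - (real m - real k) * p * binom_step d m p k)
      = binom_prob m p k * (real k * (1 - p)) * binom_step d m p j - binom_prob m p k * ((real m - real k) * p) * binom_step d m p k"
      unfolding Suc diff_Suc_1 by (simp only: right_diff_distrib[of "binom_prob m p (Suc j)"] mult.assoc)
    also have "\<dots> = ?a j - ?a k" by (simp only: death birth[OF \<open>k \<le> m\<close>])
    also have "\<dots> = binom_prob m p k * (of_bool (k = d) - binom_prob m p d)"
      using Suc by (auto simp: algebra_simps)
    finally show ?thesis .
  qed
  then show ?thesis using pos[OF \<open>k \<le> m\<close>] by simp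
qed

text \<open>Numerator and denominator can both be tiny, but they share the factor \<open>?L\<close>.
  For \<open>d \<le> k\<close> the numerator contains the tail beyond \<open>k\<close>; for
  \<open>k < d\<close> the mass at \<open>d\<close> is itself small, at most \<open>?L\<close> times
  a power of \<open>m * p\<close>. Detailed balance bounds the denominator below by
  \<open>?L * (1 - p) ^ m\<close>.\<close>

lemma binom_step_bound:
  assumes p: "0 < p" "p < 1" and "d \<le> m"
  shows "\<bar>binom_step d m p k\<bar> \<le> (1 + real m * p) ^ d / (1 - p) ^ m"
proof (cases "k < m")
  case False
  then have "binom_step d m p k = 0"
    by (cases "k = m") (simp_all add: binom_step_def binom_prob_def binomial_eq_0)
  then show ?thesis using p by simp
next
  case True
  let ?num = "binom_prob m p d * ((\<Sum>j\<le>k. binom_prob m p j) - of_bool (d \<le> k))"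
  let ?L = "real (m choose Suc k) * p ^ Suc k"
  have nonneg: "0 \<le> binom_prob m p j" for j using p by (simp add: binom_prob_nonneg)
  have split: "(\<Sum>j\<le>k. binom_prob m p j) + (\<Sum>j=Suc k..m. binom_prob m p j) = 1"
  proof -
    have "{..m} = {..k} \<union> {Suc k..m}" "{..k} \<inter> {Suc k..m} = {}" using True by auto
    then show ?thesis
      using sum.union_disjoint[of "{..k}" "{Suc k..m}" "binom_prob m p"] sum_binom_prob[of m p] by simp
  qed
  have S: "0 \<le> (\<Sum>j\<le>k. binom_prob m p j)" "0 \<le> (\<Sum>j=Suc k..m. binom_prob m p j)"
    by (simp_all add: sum_nonneg nonneg)
  have tau_le: "binom_prob m p d \<le> real (m choose d) * p ^ d"
    using p by (simp add: binom_prob_def mult_left_le power_le_one)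
  have tau_le_1: "binom_prob m p d \<le> 1"
    using member_le_sum[of d "{..m}" "binom_prob m p"] \<open>d \<le> m\<close> nonneg sum_binom_prob[of m p] by simp
  have num: "\<bar>?num\<bar> \<le> ?L * (1 + real m * p) ^ d"
  proof (cases "d \<le> k")
    case True
    then have "\<bar>?num\<bar> = binom_prob m p d * (\<Sum>j=Suc k..m. binom_prob m p j)"
      using split S nonneg by (simp add: abs_mult)
    also have "\<dots> \<le> 1 * ?L"
      using binom_prob_tail_le[of p "Suc k" m] \<open>k < m\<close> p S nonneg tau_le_1 by (intro mult_mono) auto
    also have "\<dots> \<le> ?L * (1 + real m * p) ^ d"
      using p mult_left_mono[of 1 "(1 + real m * p) ^ d" ?L] by simp
    finally show ?thesis .
  next
    case False
    then have d: "Suc k \<le> d" by simp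
    have "(m choose d) * 1 \<le> (m choose d) * (d choose Suc k)"
      using zero_less_binomial[OF d] by (intro mult_le_mono2) linarith
    also have "\<dots> = (m choose Suc k) * ((m - Suc k) choose (d - Suc k))"
      using d \<open>d \<le> m\<close> by (intro choose_mult)
    also have "\<dots> \<le> (m choose Suc k) * m ^ (d - Suc k)"
    proof (rule mult_le_mono2)
      have "(m - Suc k) choose (d - Suc k) \<le> (m - Suc k) ^ (d - Suc k)"
        using \<open>d \<le> m\<close> by (intro binomial_le_pow) simp
      also have "\<dots> \<le> m ^ (d - Suc k)" by (rule power_mono) auto
      finally show "(m - Suc k) choose (d - Suc k) \<le> m ^ (d - Suc k)" .
    qed
    finally have "real ((m choose d) * 1) \<le> real ((m choose Suc k) * m ^ (d - Suc k))"
      by (simp only: of_nat_le_iff)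
    then have choose: "real (m choose d) \<le> real (m choose Suc k) * real m ^ (d - Suc k)"
      by simp
    have "\<bar>?num\<bar> \<le> binom_prob m p d * 1"
      using False S split nonneg by (simp add: abs_mult mult_left_le)
    also have "\<dots> \<le> real (m choose d) * p ^ d" using tau_le by simp
    also have "\<dots> \<le> real (m choose Suc k) * real m ^ (d - Suc k) * p ^ d"
      using choose p by (intro mult_right_mono) auto
    also have "\<dots> = ?L * (real m * p) ^ (d - Suc k)"
      using d power_add[of p "Suc k" "d - Suc k"] by (simp add: power_mult_distrib)
    also have "\<dots> \<le> ?L * (1 + real m * p) ^ d"
    proof (rule mult_left_mono)
      have "(real m * p) ^ (d - Suc k) \<le> (1 + real m * p) ^ (d - Suc k)"
        using p by (intro power_mono) auto
      also have "\<dots> \<le> (1 + real m * p) ^ d"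
        using p by (intro power_increasing) auto
      finally show "(real m * p) ^ (d - Suc k) \<le> (1 + real m * p) ^ d" .
    qed (use p in auto)
    finally show ?thesis .
  qed
  have den: "?L * (1 - p) ^ m \<le> binom_prob m p k * ((real m - real k) * p)"
  proof -
    have "?L * (1 - p) ^ m \<le> ?L * (1 - p) ^ (m - k)"
      using p by (intro mult_left_mono power_decreasing) auto
    also have "\<dots> = ?L * ((1 - p) ^ (m - Suc k) * (1 - p))"
      using True by (simp add: Suc_diff_Suc flip: power_Suc2)
    also have "\<dots> = 1 * (?L * ((1 - p) ^ (m - Suc k) * (1 - p)))" by simp
    also have "\<dots> \<le> real (Suc k) * (?L * ((1 - p) ^ (m - Suc k) * (1 - p)))"
      using p by (intro mult_right_mono) auto
    also have "\<dots> = binom_prob m p (Suc k) * (real (Suc k) * (1 - p))"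
      by (simp add: binom_prob_def)
    finally show ?thesis using binom_prob_Suc[OF True] by simp
  qed
  have L: "0 < ?L" using True p by (simp add: Suc_leI)
  have Lq: "0 < ?L * (1 - p) ^ m" using L p by simp
  have "\<bar>binom_step d m p k\<bar> = \<bar>?num\<bar> / (binom_prob m p k * ((real m - real k) * p))"
    using Lq den by (simp add: binom_step_def abs_divide)
  also have "\<dots> \<le> ?L * (1 + real m * p) ^ d / (?L * (1 - p) ^ m)"
    using num den Lq p L by (intro frac_le) auto
  also have "\<dots> = (1 + real m * p) ^ d / (1 - p) ^ m"
    by (rule mult_divide_mult_cancel_left[OF less_imp_neq[OF L, symmetric]])
  finally show ?thesis .
qed

section \<open>Success counts on the cube and their law\<close>

definition num_true :: "'a set \<Rightarrow> ('a \<Rightarrow> bool) \<Rightarrow> nat" where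
  "num_true A X = card {e \<in> A. X e}"

lemma num_true_ignores: "e \<notin> A \<Longrightarrow> num_true A (X(e := b)) = num_true A X"
  unfolding num_true_def by (rule arg_cong[of _ _ card]) auto

lemma num_true_upd:
  assumes "finite A" "e \<in> A"
  shows "num_true A (X(e := b)) = num_true (A - {e}) X + of_bool b"
proof -
  have "{f \<in> A. (X(e := b)) f} = (if b then insert e {f \<in> A - {e}. X f} else {f \<in> A - {e}. X f})"
    using assms by auto
  then show ?thesis using assms by (simp add: num_true_def)
qed

lemma num_true_remove:
  assumes "finite A" "e \<in> A"
  shows "num_true A X = num_true (A - {e}) X + of_bool (X e)"
  using num_true_upd[OF assms, of X "X e"] by simp

lemma num_true_le_card: "finite A \<Longrightarrow> num_true A X \<le> card A"
  unfolding num_true_def by (intro card_mono) auto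

lemma num_true_upd_le: "finite A \<Longrightarrow> num_true A (X(e := b)) \<le> num_true A X + 1"
proof (cases "e \<in> A")
  case True
  assume "finite A"
  then show ?thesis
    using num_true_upd[OF _ True, of X b] num_true_remove[OF _ True, of X] by simp
qed (simp add: num_true_ignores)

context bernoulli_cube
begin

text \<open>Without its own coordinate, each of the \<open>?D\<close> successes sees the count
  \<open>?D - 1\<close> and each failure sees \<open>?D\<close>. Grouping the sum accordingly gives
  the left side of \<open>binom_step_eq\<close>.\<close>

lemma poisson_num_true:
  assumes p: "0 < p" "p < 1" and "finite A" "d \<le> card A"
  shows "(\<Sum>e\<in>A. (of_bool (X e) - p) * binom_step d (card A) p (num_true A (X(e := False)))) =
    of_bool (num_true A X = d) - binom_prob (card A) p d"
proof -
  let ?D = "num_true A X" and ?g = "binom_step d (card A) p"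
  have "(of_bool (X e) - p) * ?g (num_true A (X(e := False))) =
      (if X e then (1 - p) * ?g (?D - 1) else - p * ?g ?D)" if "e \<in> A" for e
    using num_true_upd[OF \<open>finite A\<close> that, of X False] num_true_remove[OF \<open>finite A\<close> that, of X]
    by simp
  then have "(\<Sum>e\<in>A. (of_bool (X e) - p) * ?g (num_true A (X(e := False)))) =
      (\<Sum>e\<in>A. if X e then (1 - p) * ?g (?D - 1) else - p * ?g ?D)"
    by (intro sum.cong) auto
  also have "\<dots> = real ?D * ((1 - p) * ?g (?D - 1)) + real (card {e \<in> A. \<not> X e}) * (- p * ?g ?D)"
    using \<open>finite A\<close> by (simp add: sum.If_cases num_true_def Int_def)
  also have "real (card {e \<in> A. \<not> X e}) = real (card A) - real ?D"
  proof -
    have "card A = card {e \<in> A. X e} + card {e \<in> A. \<not> X e}"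
      using \<open>finite A\<close> by (subst card_Un_disjoint[symmetric]) (auto intro: arg_cong[of _ _ card])
    then show ?thesis by (simp add: num_true_def)
  qed
  also have "real ?D * ((1 - p) * ?g (?D - 1)) + (real (card A) - real ?D) * (- p * ?g ?D) =
      of_bool (?D = d) - binom_prob (card A) p d"
    using binom_step_eq[OF p \<open>d \<le> card A\<close> num_true_le_card[OF \<open>finite A\<close>], of X]
    by (simp add: mult.assoc)
  finally show ?thesis .
qed

text \<open>The Poisson equation already yields the binomial law: every summand is centred, because
  its coefficient ignores its own coordinate.\<close>

lemma E_num_true_eq:
  assumes p: "0 < p" "p < 1" and "A \<subseteq> I"
  shows "E (\<lambda>X. of_bool (num_true A X = d)) = binom_prob (card A) p d"
proof -
  have finA: "finite A" using assms finite_I finite_subset by blast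
  show ?thesis
  proof (cases "d \<le> card A")
    case True
    have "E (\<lambda>X. of_bool (num_true A X = d)) - binom_prob (card A) p d =
        E (\<lambda>X. of_bool (num_true A X = d) - binom_prob (card A) p d)"
      by (simp add: E_diff)
    also have "\<dots> = (\<Sum>e\<in>A. E (\<lambda>X. (of_bool (X e) - p) * binom_step d (card A) p (num_true A (X(e := False))) * 1))"
      by (simp add: poisson_num_true[OF p finA True, symmetric] E_sum)
    also have "\<dots> = (\<Sum>e\<in>A. 0)"
    proof (rule sum.cong[OF refl])
      fix e assume "e \<in> A"
      then show "E (\<lambda>X. (of_bool (X e) - p) * binom_step d (card A) p (num_true A (X(e := False))) * 1) = 0"
        using assms by (subst E_ibp) (auto simp: ignores_def coord_diff_def)
    qed
    finally show ?thesis by simp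
  next
    case False
    have "num_true A X \<noteq> d" for X using False num_true_le_card[OF finA, of X] by auto
    then show ?thesis using False by (simp add: binom_prob_def binomial_eq_0)
  qed
qed

lemma E_num_true_ge:
  assumes p: "0 < p" "p < 1" and "A \<subseteq> I"
  shows "E (\<lambda>X. of_bool (k \<le> num_true A X)) \<le> (real (card A) * p) ^ k"
proof (cases "k \<le> card A")
  case True
  have finA: "finite A" using assms finite_I finite_subset by blast
  have "(\<lambda>X. of_bool (k \<le> num_true A X)) = (\<lambda>X. \<Sum>j=k..card A. of_bool (num_true A X = j) :: real)"
  proof
    fix X
    have "(\<Sum>j=k..card A. of_bool (num_true A X = j) :: real) = (\<Sum>j=k..card A. if j = num_true A X then 1 else 0)"
      by (intro sum.cong) auto
    then show "of_bool (k \<le> num_true A X) = (\<Sum>j=k..card A. of_bool (num_true A X = j) :: real)"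
      using num_true_le_card[OF finA, of X] by simp
  qed
  then have "E (\<lambda>X. of_bool (k \<le> num_true A X)) = (\<Sum>j=k..card A. binom_prob (card A) p j)"
    by (simp only: E_sum E_num_true_eq[OF assms])
  also have "\<dots> \<le> real (card A choose k) * p ^ k"
    using p True by (intro binom_prob_tail_le) auto
  also have "\<dots> \<le> real (card A) ^ k * p ^ k"
    using p True binomial_le_pow[OF True] by (intro mult_right_mono) (simp_all flip: of_nat_power)
  finally show ?thesis by (simp add: power_mult_distrib)
next
  case False
  have finA: "finite A" using assms finite_I finite_subset by blast
  have "\<not> k \<le> num_true A X" for X using False num_true_le_card[OF finA, of X] by auto
  then show ?thesis using p by simp
qed

end

section \<open>Degrees in the random graph\<close>

definition incident :: "nat \<Rightarrow> nat \<Rightarrow> nat set set" where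
  "incident n v = {e \<in> vertex_pairs n. v \<in> e}"

lemma finite_vertex_pairs: "finite (vertex_pairs n)"
  by (rule finite_subset[of _ "Pow {1..n}"]) (auto simp: vertex_pairs_def)

lemma vertex_pairsD:
  assumes "e \<in> vertex_pairs n"
  shows "card e = 2" "finite e" "e \<subseteq> {1..n}"
  using assms finite_subset by (auto simp: vertex_pairs_def)

lemma incident_subset: "incident n v \<subseteq> vertex_pairs n"
  by (auto simp: incident_def)

lemma finite_incident: "finite (incident n v)"
  using finite_subset[OF incident_subset finite_vertex_pairs] .

lemma incident_eq_image:
  assumes "v \<in> {1..n}"
  shows "incident n v = (\<lambda>w. {v, w}) ` ({1..n} - {v})"
proof -
  have "e \<in> (\<lambda>w. {v, w}) ` ({1..n} - {v})" if "e \<in> incident n v" for e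
  proof -
    from that have e: "e \<subseteq> {1..n}" "card e = 2" "v \<in> e" by (auto simp: incident_def vertex_pairs_def)
    then obtain w where "e = {v, w}" "w \<noteq> v" by (auto simp: card_2_iff)
    with e show ?thesis by auto
  qed
  then show ?thesis using assms by (auto simp: incident_def vertex_pairs_def)
qed

lemma inj_on_pair: "inj_on (\<lambda>w. {v, w}) A"
  by (auto simp: inj_on_def doubleton_eq_iff)

lemma card_incident: "v \<in> {1..n} \<Longrightarrow> card (incident n v) = n - 1"
  by (simp add: incident_eq_image card_image inj_on_pair)

lemma vdegree_eq_num_true:
  assumes "v \<in> {1..n}"
  shows "vdegree n X v = num_true (incident n v) X"
proof -
  have "vdegree n X v = card {w \<in> {1..n} - {v}. X {v, w}}"
    by (simp add: vdegree_def edge_ind_def sum.If_cases of_bool_def Int_def)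
       (intro arg_cong[of _ _ card], auto)
  also have "\<dots> = card ((\<lambda>w. {v, w}) ` {w \<in> {1..n} - {v}. X {v, w}})"
    by (rule card_image[symmetric, OF inj_on_pair])
  also have "(\<lambda>w. {v, w}) ` {w \<in> {1..n} - {v}. X {v, w}} = {e \<in> incident n v. X e}"
    unfolding incident_eq_image[OF assms] by auto
  finally show ?thesis by (simp add: num_true_def)
qed

lemma sum_edges_vertices:
  "(\<Sum>e\<in>vertex_pairs n. \<Sum>v\<in>e. F v e) = (\<Sum>v\<in>{1..n}. \<Sum>e\<in>incident n v. F v e)"
proof -
  have "(\<Sum>e\<in>vertex_pairs n. \<Sum>v\<in>e. F v e) = (\<Sum>e\<in>vertex_pairs n. \<Sum>v | v \<in> {1..n} \<and> v \<in> e. F v e)"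
    by (intro sum.cong refl) (use vertex_pairsD in blast)
  also have "\<dots> = (\<Sum>v\<in>{1..n}. \<Sum>e | e \<in> vertex_pairs n \<and> v \<in> e. F v e)"
    by (rule sum.swap_restrict) (simp_all add: finite_vertex_pairs)
  finally show ?thesis by (simp add: incident_def)
qed

lemma card_vertex_pairs: "2 * real (card (vertex_pairs n)) = real n * real (n - 1)"
proof -
  have "2 * real (card (vertex_pairs n)) = (\<Sum>e\<in>vertex_pairs n. real (card e))"
    by (simp add: vertex_pairsD(1))
  also have "\<dots> = (\<Sum>e\<in>vertex_pairs n. \<Sum>v\<in>e. 1)" by simp
  also have "\<dots> = (\<Sum>v\<in>{1..n}. \<Sum>e\<in>incident n v. 1)" by (rule sum_edges_vertices)
  also have "\<dots> = (\<Sum>v\<in>{1..n}. real (n - 1))"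
    by (intro sum.cong refl) (simp add: card_incident)
  finally show ?thesis by (cases n) simp_all
qed

definition neighbours :: "nat \<Rightarrow> nat set \<Rightarrow> nat set set" where
  "neighbours n e = {f \<in> vertex_pairs n. e \<inter> f \<noteq> {}}"

lemma neighbours_subset: "neighbours n e \<subseteq> vertex_pairs n"
  by (auto simp: neighbours_def)

lemma finite_neighbours: "finite (neighbours n e)"
  using finite_subset[OF neighbours_subset finite_vertex_pairs] .

lemma card_neighbours:
  assumes "e \<in> vertex_pairs n"
  shows "real (card (neighbours n e)) \<le> 2 * real (n - 1)"
proof -
  note e = vertex_pairsD[OF assms]
  have "neighbours n e = (\<Union>v\<in>e. incident n v)"
    by (auto simp: neighbours_def incident_def)
  then have "card (neighbours n e) \<le> (\<Sum>v\<in>e. card (incident n v))"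
    using card_UN_le[OF e(2)] by simp
  also have "\<dots> = (\<Sum>v\<in>e. n - 1)"
    using e(3) by (intro sum.cong refl card_incident) auto
  also have "\<dots> = 2 * (n - 1)" using e by simp
  finally have "real (card (neighbours n e)) \<le> real (2 * (n - 1))" by (simp only: of_nat_le_iff)
  then show ?thesis by simp
qed

section \<open>Degrees and their response to flipping an edge\<close>

abbreviation deg :: "nat \<Rightarrow> nat \<Rightarrow> (nat set \<Rightarrow> bool) \<Rightarrow> nat" where
  "deg n v \<equiv> num_true (incident n v)"

lemma deg_ignores: "v \<notin> e \<Longrightarrow> deg n v (X(e := b)) = deg n v X"
  by (rule num_true_ignores) (simp add: incident_def)

lemma deg_True:
  assumes "e \<in> vertex_pairs n" "v \<in> e"
  shows "deg n v (X(e := True)) = deg n v (X(e := False)) + 1"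
  using assms by (subst (1 2) num_true_upd) (auto simp: incident_def finite_vertex_pairs)

lemma deg_False_le: "deg n v (X(e := False)) \<le> deg n v X"
proof (cases "e \<in> incident n v")
  case True
  then show ?thesis
    using num_true_upd[OF finite_incident True, of X False] num_true_remove[OF finite_incident True, of X] by simp
qed (simp add: num_true_ignores)

text \<open>Only the two endpoints of \<open>e\<close> see the flip, each moving up by one from its
  degree without \<open>e\<close>.\<close>

lemma coord_diff_vertex_sum:
  assumes "e \<in> vertex_pairs n"
  shows "coord_diff e (\<lambda>X. \<Sum>v\<in>{1..n}. \<phi> (deg n v X)) X =
    (\<Sum>v\<in>e. \<phi> (deg n v (X(e := False)) + 1) - \<phi> (deg n v (X(e := False))))"
proof -
  have "coord_diff e (\<lambda>X. \<Sum>v\<in>{1..n}. \<phi> (deg n v X)) X =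
      (\<Sum>v\<in>{1..n}. \<phi> (deg n v (X(e := True))) - \<phi> (deg n v (X(e := False))))"
    by (simp add: coord_diff_def sum_subtractf)
  also have "\<dots> = (\<Sum>v\<in>e. \<phi> (deg n v (X(e := True))) - \<phi> (deg n v (X(e := False))))"
    using vertex_pairsD[OF assms] by (intro sum.mono_neutral_right) (auto simp: deg_ignores)
  also have "\<dots> = (\<Sum>v\<in>e. \<phi> (deg n v (X(e := False)) + 1) - \<phi> (deg n v (X(e := False))))"
    by (intro sum.cong refl) (simp only: deg_True[OF assms])
  finally show ?thesis .
qed

lemma coord_diff_vertex_sum_ignores:
  assumes "e \<in> vertex_pairs n" "e \<inter> f = {}"
  shows "ignores (coord_diff e (\<lambda>X. \<Sum>v\<in>{1..n}. \<phi> (deg n v X))) f"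
proof -
  have "e \<noteq> f" using assms vertex_pairsD(1)[OF assms(1)] by auto
  have "v \<notin> f" if "v \<in> e" for v using assms that by auto
  then have "deg n v ((X(f := b))(e := False)) = deg n v (X(e := False))" if "v \<in> e" for v X b
    using that \<open>e \<noteq> f\<close> by (simp add: fun_upd_twist deg_ignores)
  then show ?thesis
    unfolding ignores_def coord_diff_vertex_sum[OF assms(1)] by simp
qed

text \<open>A weight that carries the smallness \<open>theta ^ (d - j)\<close>. Slack
  \<open>j = 1\<close> bounds the effect of an edge on the count, and \<open>j = 2\<close> leaves
  room for a second flip. For \<open>d = 1\<close> the truncated \<open>d - 2\<close> is 0 and the
  weight is the number of endpoints.\<close>

definition near :: "nat \<Rightarrow> nat \<Rightarrow> nat \<Rightarrow> nat set \<Rightarrow> (nat set \<Rightarrow> bool) \<Rightarrow> real" where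
  "near n d j e X = (\<Sum>v\<in>e. of_bool (d - j \<le> deg n v X))"

lemma near_nonneg: "0 \<le> near n d j e X"
  by (simp add: near_def sum_nonneg)

lemma near_le_2: "e \<in> vertex_pairs n \<Longrightarrow> near n d j e X \<le> 2"
  using sum_bounded_above[of e "\<lambda>v. of_bool (d - j \<le> deg n v X)" "1::real"] vertex_pairsD[of e n]
  by (simp add: near_def)

lemma near_upd_le: "near n d 1 e (X(f := b)) \<le> near n d 2 e X"
  unfolding near_def
proof (rule sum_mono)
  fix v
  show "of_bool (d - 1 \<le> deg n v (X(f := b))) \<le> (of_bool (d - 2 \<le> deg n v X) :: real)"
    using num_true_upd_le[OF finite_incident, of n v X f b] by auto
qed

locale er_graph =
  fixes n d :: nat and p :: real
  assumes d_pos: "1 \<le> d" and d_less: "d < n" and p_pos: "0 < p" and p_less_1: "p < 1"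
begin

sublocale bernoulli_cube "vertex_pairs n" p
  using finite_vertex_pairs p_pos p_less_1 by unfold_locales auto

abbreviation I :: "nat set set" where "I \<equiv> vertex_pairs n"

definition theta :: real where "theta = real (n - 1) * p"

lemma theta_nonneg: "0 \<le> theta"
  using p_pos by (simp add: theta_def)

lemma card_I_p: "2 * (real (card I) * p) = real n * theta"
  using card_vertex_pairs[of n] by (simp add: theta_def flip: mult.assoc)

lemma E_near:
  assumes "e \<in> I"
  shows "E (near n d j e) \<le> 2 * theta ^ (d - j)"
proof -
  note e = vertex_pairsD[OF assms]
  have "E (near n d j e) = (\<Sum>v\<in>e. E (\<lambda>X. of_bool (d - j \<le> deg n v X)))"
    unfolding near_def[abs_def] by (rule E_sum)
  also have "\<dots> \<le> (\<Sum>v\<in>e. theta ^ (d - j))"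
  proof (rule sum_mono)
    fix v assume "v \<in> e"
    then have "card (incident n v) = n - 1" using e by (intro card_incident) auto
    then show "E (\<lambda>X. of_bool (d - j \<le> deg n v X)) \<le> theta ^ (d - j)"
      using E_num_true_ge[OF p_pos p_less_1 incident_subset, of "d - j" v] by (simp add: theta_def)
  qed
  finally show ?thesis using e by simp
qed

lemma pp: "0 \<le> p * (1 - p)" "p * (1 - p) \<le> p"
  using p_pos p_less_1 by (auto simp: mult_left_le)

section \<open>Second moments of local sums over edges\<close>

context
  fixes u :: "nat set \<Rightarrow> (nat set \<Rightarrow> bool) \<Rightarrow> real" and \<kappa> :: real
  assumes kappa: "0 \<le> \<kappa>"
    and u_bound: "\<And>e X. e \<in> I \<Longrightarrow> \<bar>u e X\<bar> \<le> \<kappa> * near n d 1 e X"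
    and u_own: "\<And>e. e \<in> I \<Longrightarrow> ignores (u e) e"
    and u_local: "\<And>e f. e \<in> I \<Longrightarrow> f \<in> I \<Longrightarrow> e \<inter> f = {} \<Longrightarrow> ignores (u e) f"
begin

lemma coord_diff_u_bound:
  assumes "e \<in> I"
  shows "\<bar>coord_diff f (u e) X\<bar> \<le> 2 * \<kappa> * near n d 2 e X"
proof -
  have "\<bar>u e (X(f := b))\<bar> \<le> \<kappa> * near n d 2 e X" for b
    using u_bound[OF assms] mult_left_mono[OF near_upd_le kappa] by (rule order_trans)
  from this[of True] this[of False] show ?thesis by (simp add: coord_diff_def)
qed

lemma coord_diff_u_zero:
  assumes "e \<in> I" "f \<in> I" "f \<notin> neighbours n e"
  shows "coord_diff f (u e) X = 0"
proof -
  have "ignores (u e) f" using assms by (intro u_local) (auto simp: neighbours_def)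
  then show ?thesis by (simp add: coord_diff_def ignores_def)
qed

text \<open>In the isometry the diagonal costs \<open>card I * p\<close>, which is
  \<open>n * theta / 2\<close>. An off-diagonal pair must share a vertex; this leaves at most
  \<open>2 * (n - 1)\<close> partners, and the second factor \<open>p\<close> turns their number
  into a factor \<open>theta\<close>.\<close>

lemma divergence_second_moment:
  "E (\<lambda>X. (\<Sum>e\<in>I. (of_bool (X e) - p) * u e X)\<^sup>2) \<le>
     2 * \<kappa>\<^sup>2 * real n * theta * theta ^ (d - 1) + 16 * \<kappa>\<^sup>2 * real n * theta\<^sup>2 * theta ^ (d - 2)"
proof -
  have diag: "p * (1 - p) * E (\<lambda>X. (u e X)\<^sup>2) \<le> p * (4 * \<kappa>\<^sup>2 * theta ^ (d - 1))" if "e \<in> I" for e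
  proof (rule mult_mono)
    have "(u e X)\<^sup>2 \<le> (2 * \<kappa>\<^sup>2) * near n d 1 e X" for X
    proof -
      have "(u e X)\<^sup>2 = \<bar>u e X\<bar>\<^sup>2" by simp
      also have "\<dots> \<le> (\<kappa> * near n d 1 e X)\<^sup>2"
        by (rule power_mono[OF u_bound[OF that]]) simp
      also have "\<dots> = \<kappa>\<^sup>2 * (near n d 1 e X * near n d 1 e X)"
        by (simp add: power2_eq_square mult_ac)
      \<comment> \<open>One factor \<open>near\<close> is kept for its small expectation, the other
        is bounded by 2.\<close>
      also have "\<dots> \<le> \<kappa>\<^sup>2 * (2 * near n d 1 e X)"
        by (intro mult_left_mono mult_right_mono near_le_2 that near_nonneg) simp
      finally show ?thesis by (simp add: mult_ac)
    qed
    then have "E (\<lambda>X. (u e X)\<^sup>2) \<le> E (\<lambda>X. (2 * \<kappa>\<^sup>2) * near n d 1 e X)" by (rule E_mono)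
    also have "\<dots> \<le> (2 * \<kappa>\<^sup>2) * (2 * theta ^ (d - 1))"
      unfolding E_cmult by (intro mult_left_mono E_near that) simp
    finally show "E (\<lambda>X. (u e X)\<^sup>2) \<le> 4 * \<kappa>\<^sup>2 * theta ^ (d - 1)" by simp
  qed (use pp p_pos in \<open>auto intro: E_nonneg\<close>)
  let ?D = "\<lambda>e f. E (\<lambda>X. coord_diff f (u e) X * coord_diff e (u f) X)"
  have off: "(p * (1 - p))\<^sup>2 * ?D e f \<le> p\<^sup>2 * (16 * \<kappa>\<^sup>2 * theta ^ (d - 2))"
    if "e \<in> I" "f \<in> I" for e f
  proof -
    have "coord_diff f (u e) X * coord_diff e (u f) X \<le> (8 * \<kappa>\<^sup>2) * near n d 2 e X" for X
    proof -
      have "coord_diff f (u e) X * coord_diff e (u f) X \<le> \<bar>coord_diff f (u e) X\<bar> * \<bar>coord_diff e (u f) X\<bar>"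
        by (simp flip: abs_mult)
      also have "\<dots> \<le> (2 * \<kappa> * near n d 2 e X) * (2 * \<kappa> * near n d 2 f X)"
        using coord_diff_u_bound that kappa by (intro mult_mono) (auto simp: near_nonneg)
      also have "\<dots> = 4 * \<kappa>\<^sup>2 * near n d 2 e X * near n d 2 f X"
        by (simp add: power2_eq_square mult_ac)
      also have "\<dots> \<le> 4 * \<kappa>\<^sup>2 * near n d 2 e X * 2"
        using that by (intro mult_left_mono near_le_2) (auto simp: near_nonneg)
      finally show ?thesis by simp
    qed
    then have "?D e f \<le> E (\<lambda>X. (8 * \<kappa>\<^sup>2) * near n d 2 e X)" by (rule E_mono)
    also have "\<dots> \<le> (8 * \<kappa>\<^sup>2) * (2 * theta ^ (d - 2))"
      unfolding E_cmult by (intro mult_left_mono E_near that) simp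
    finally have "(p * (1 - p))\<^sup>2 * ?D e f \<le> (p * (1 - p))\<^sup>2 * (16 * \<kappa>\<^sup>2 * theta ^ (d - 2))"
      by (intro mult_left_mono) auto
    also have "\<dots> \<le> p\<^sup>2 * (16 * \<kappa>\<^sup>2 * theta ^ (d - 2))"
      using pp theta_nonneg by (intro mult_right_mono power_mono) auto
    finally show ?thesis .
  qed
  have row: "(\<Sum>f\<in>I - {e}. (p * (1 - p))\<^sup>2 * ?D e f) \<le> 2 * real (n - 1) * (p\<^sup>2 * (16 * \<kappa>\<^sup>2 * theta ^ (d - 2)))"
    if "e \<in> I" for e
  proof -
    have "(\<Sum>f\<in>I - {e}. (p * (1 - p))\<^sup>2 * ?D e f) = (\<Sum>f\<in>neighbours n e - {e}. (p * (1 - p))\<^sup>2 * ?D e f)"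
    proof (rule sum.mono_neutral_right)
      show "\<forall>f\<in>I - {e} - (neighbours n e - {e}). (p * (1 - p))\<^sup>2 * ?D e f = 0"
        using coord_diff_u_zero[OF that] by auto
    qed (use neighbours_subset finite_vertex_pairs in auto)
    also have "\<dots> \<le> (\<Sum>f\<in>neighbours n e - {e}. p\<^sup>2 * (16 * \<kappa>\<^sup>2 * theta ^ (d - 2)))"
      using that neighbours_subset by (intro sum_mono off) auto
    also have "\<dots> \<le> (\<Sum>f\<in>neighbours n e. p\<^sup>2 * (16 * \<kappa>\<^sup>2 * theta ^ (d - 2)))"
      using theta_nonneg by (intro sum_mono2 finite_neighbours) auto
    also have "\<dots> = real (card (neighbours n e)) * (p\<^sup>2 * (16 * \<kappa>\<^sup>2 * theta ^ (d - 2)))" by simp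
    also have "\<dots> \<le> 2 * real (n - 1) * (p\<^sup>2 * (16 * \<kappa>\<^sup>2 * theta ^ (d - 2)))"
      using theta_nonneg by (intro mult_right_mono card_neighbours that) simp
    finally show ?thesis .
  qed
  have "E (\<lambda>X. (\<Sum>e\<in>I. (of_bool (X e) - p) * u e X)\<^sup>2) \<le>
      (\<Sum>e\<in>I. p * (4 * \<kappa>\<^sup>2 * theta ^ (d - 1))) + (\<Sum>e\<in>I. 2 * real (n - 1) * (p\<^sup>2 * (16 * \<kappa>\<^sup>2 * theta ^ (d - 2))))"
    by (subst divergence_isometry[where u = u], erule u_own, intro add_mono sum_mono diag row)
  also have "\<dots> = 2 * (real (card I) * p) * (2 * \<kappa>\<^sup>2 * theta ^ (d - 1)) +
      2 * (real (card I) * p) * theta * (16 * \<kappa>\<^sup>2 * theta ^ (d - 2))"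
    by (simp add: theta_def power2_eq_square mult_ac)
  also have "\<dots> = 2 * \<kappa>\<^sup>2 * real n * theta * theta ^ (d - 1) + 16 * \<kappa>\<^sup>2 * real n * theta\<^sup>2 * theta ^ (d - 2)"
    unfolding card_I_p by (simp add: power2_eq_square mult_ac)
  finally show ?thesis .
qed

text \<open>By the Poincare inequality it suffices to bound the effect of a flip at
  \<open>f\<close>, which is felt only by the neighbours of \<open>f\<close>. In its square one
  neighbour sum is bounded by its size and the other is kept for its expectation; both factors
  \<open>n - 1\<close> pair with a \<open>p\<close> to give \<open>theta\<^sup>2\<close>.\<close>

lemma edge_sum_variance:
  defines "T \<equiv> \<lambda>X. \<Sum>e\<in>I. p * (1 - p) * u e X"
  shows "E (\<lambda>X. (T X - E T)\<^sup>2) \<le> 32 * \<kappa>\<^sup>2 * real n * theta * theta\<^sup>2 * theta ^ (d - 2)"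
proof -
  have sq: "(coord_diff f T X)\<^sup>2 \<le> (16 * p\<^sup>2 * \<kappa>\<^sup>2 * real (n - 1)) * (\<Sum>e\<in>neighbours n f. near n d 2 e X)"
    if "f \<in> I" for f X
  proof -
    let ?S = "\<Sum>e\<in>neighbours n f. near n d 2 e X"
    have S: "0 \<le> ?S" "?S \<le> 4 * real (n - 1)"
    proof -
      show "0 \<le> ?S" by (simp add: sum_nonneg near_nonneg)
      have "?S \<le> real (card (neighbours n f)) * 2"
        using neighbours_subset by (intro sum_bounded_above near_le_2) blast
      also have "\<dots> \<le> 2 * real (n - 1) * 2"
        by (intro mult_right_mono card_neighbours that) simp
      finally show "?S \<le> 4 * real (n - 1)" by simp
    qed
    have "coord_diff f T X = (\<Sum>e\<in>I. p * (1 - p) * coord_diff f (u e) X)"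
      by (simp add: T_def coord_diff_def sum_subtractf right_diff_distrib)
    also have "\<dots> = (\<Sum>e\<in>neighbours n f. p * (1 - p) * coord_diff f (u e) X)"
    proof (rule sum.mono_neutral_right)
      have "coord_diff f (u e) X = 0" if "e \<in> I - neighbours n f" for e
        using that \<open>f \<in> I\<close> by (intro coord_diff_u_zero) (auto simp: neighbours_def)
      then show "\<forall>e\<in>I - neighbours n f. p * (1 - p) * coord_diff f (u e) X = 0" by simp
    qed (use neighbours_subset finite_vertex_pairs in auto)
    also have "\<bar>\<dots>\<bar> \<le> (\<Sum>e\<in>neighbours n f. p * (2 * \<kappa> * near n d 2 e X))"
    proof (rule order_trans[OF sum_abs sum_mono])
      fix e assume "e \<in> neighbours n f"
      then have "e \<in> I" using neighbours_subset by auto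
      then show "\<bar>p * (1 - p) * coord_diff f (u e) X\<bar> \<le> p * (2 * \<kappa> * near n d 2 e X)"
        using pp p_pos coord_diff_u_bound[of e f X] unfolding abs_mult[of "p * (1 - p)"]
        by (intro mult_mono) auto
    qed
    also have "\<dots> = 2 * p * \<kappa> * ?S" by (simp add: sum_distrib_left mult_ac)
    finally have "\<bar>coord_diff f T X\<bar>\<^sup>2 \<le> (2 * p * \<kappa> * ?S)\<^sup>2" by (rule power_mono) simp
    also have "\<dots> = 4 * p\<^sup>2 * \<kappa>\<^sup>2 * ?S * ?S" by (simp add: power2_eq_square mult_ac)
    also have "\<dots> \<le> 4 * p\<^sup>2 * \<kappa>\<^sup>2 * ?S * (4 * real (n - 1))"
      using S by (intro mult_left_mono) auto
    finally show ?thesis by (simp add: mult_ac)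
  qed
  have row: "p * (1 - p) * E (\<lambda>X. (coord_diff f T X)\<^sup>2) \<le> p * (64 * \<kappa>\<^sup>2 * theta\<^sup>2 * theta ^ (d - 2))"
    if "f \<in> I" for f
  proof (rule mult_mono)
    have "E (\<lambda>X. (coord_diff f T X)\<^sup>2) \<le>
        E (\<lambda>X. (16 * p\<^sup>2 * \<kappa>\<^sup>2 * real (n - 1)) * (\<Sum>e\<in>neighbours n f. near n d 2 e X))"
      by (intro E_mono sq that)
    also have "\<dots> = (16 * p\<^sup>2 * \<kappa>\<^sup>2 * real (n - 1)) * (\<Sum>e\<in>neighbours n f. E (near n d 2 e))"
      by (simp only: E_cmult E_sum)
    also have "\<dots> \<le> (16 * p\<^sup>2 * \<kappa>\<^sup>2 * real (n - 1)) * (2 * real (n - 1) * (2 * theta ^ (d - 2)))"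
    proof (rule mult_left_mono)
      have "(\<Sum>e\<in>neighbours n f. E (near n d 2 e)) \<le> real (card (neighbours n f)) * (2 * theta ^ (d - 2))"
        using neighbours_subset by (intro sum_bounded_above E_near) blast
      also have "\<dots> \<le> 2 * real (n - 1) * (2 * theta ^ (d - 2))"
        using theta_nonneg by (intro mult_right_mono card_neighbours that) simp
      finally show "(\<Sum>e\<in>neighbours n f. E (near n d 2 e)) \<le> 2 * real (n - 1) * (2 * theta ^ (d - 2))" .
    qed simp
    also have "\<dots> = 64 * \<kappa>\<^sup>2 * theta\<^sup>2 * theta ^ (d - 2)"
      by (simp add: theta_def power2_eq_square mult_ac)
    finally show "E (\<lambda>X. (coord_diff f T X)\<^sup>2) \<le> 64 * \<kappa>\<^sup>2 * theta\<^sup>2 * theta ^ (d - 2)" .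
  qed (use pp p_pos in \<open>auto intro: E_nonneg\<close>)
  have "E (\<lambda>X. (T X - E T)\<^sup>2) \<le> (\<Sum>f\<in>I. p * (64 * \<kappa>\<^sup>2 * theta\<^sup>2 * theta ^ (d - 2)))"
    using poincare by (rule order_trans) (intro sum_mono row)
  also have "\<dots> = 2 * (real (card I) * p) * (32 * \<kappa>\<^sup>2 * theta\<^sup>2 * theta ^ (d - 2))"
    by (simp add: mult_ac)
  also have "\<dots> = 32 * \<kappa>\<^sup>2 * real n * theta * theta\<^sup>2 * theta ^ (d - 2)"
    unfolding card_I_p by (simp add: mult_ac)
  finally show ?thesis .
qed

end

section \<open>The degree count, its Poisson equation and its variance\<close>

definition tau :: real where "tau = binom_prob (n - 1) p d"

definition num_deg :: "(nat set \<Rightarrow> bool) \<Rightarrow> real" where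
  "num_deg X = (\<Sum>v\<in>{1..n}. of_bool (deg n v X = d))"

text \<open>The inner sum is a discrete antiderivative, so flipping an edge returns
  \<open>binom_step\<close> at the degrees without that edge.\<close>

definition poisson_sol :: "(nat set \<Rightarrow> bool) \<Rightarrow> real" where
  "poisson_sol X = (\<Sum>v\<in>{1..n}. \<Sum>j<deg n v X. binom_step d (n - 1) p j)"

lemma E_deg_eq: "v \<in> {1..n} \<Longrightarrow> E (\<lambda>X. of_bool (deg n v X = d)) = tau"
  using E_num_true_eq[OF p_pos p_less_1 incident_subset] by (simp add: card_incident tau_def)

lemma E_num_deg: "E num_deg = real n * tau"
  unfolding num_deg_def[abs_def] E_sum using E_deg_eq by simp

lemma coord_diff_poisson_sol:
  assumes "e \<in> I"
  shows "coord_diff e poisson_sol X = (\<Sum>v\<in>e. binom_step d (n - 1) p (deg n v (X(e := False))))"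
  using coord_diff_vertex_sum[OF assms, of "\<lambda>k. \<Sum>j<k. binom_step d (n - 1) p j" X]
  by (simp add: poisson_sol_def[abs_def])

text \<open>Summing over edges and then endpoints is summing over vertices and then incident edges;
  at each vertex the equation is that of the binomial count.\<close>

lemma poisson_sol_eq:
  "(\<Sum>e\<in>I. (of_bool (X e) - p) * coord_diff e poisson_sol X) = num_deg X - E num_deg"
proof -
  have "(\<Sum>e\<in>I. (of_bool (X e) - p) * coord_diff e poisson_sol X) =
      (\<Sum>e\<in>I. \<Sum>v\<in>e. (of_bool (X e) - p) * binom_step d (n - 1) p (deg n v (X(e := False))))"
    by (intro sum.cong refl) (simp add: coord_diff_poisson_sol sum_distrib_left)
  also have "\<dots> = (\<Sum>v\<in>{1..n}. \<Sum>e\<in>incident n v. (of_bool (X e) - p) * binom_step d (n - 1) p (deg n v (X(e := False))))"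
    by (rule sum_edges_vertices)
  also have "\<dots> = (\<Sum>v\<in>{1..n}. of_bool (deg n v X = d) - tau)"
  proof (rule sum.cong[OF refl])
    fix v assume v: "v \<in> {1..n}"
    show "(\<Sum>e\<in>incident n v. (of_bool (X e) - p) * binom_step d (n - 1) p (deg n v (X(e := False)))) =
        of_bool (deg n v X = d) - tau"
      using poisson_num_true[OF p_pos p_less_1 finite_incident, of d n v X] d_less
      unfolding card_incident[OF v] tau_def by simp
  qed
  also have "\<dots> = num_deg X - E num_deg"
    by (simp add: sum_subtractf num_deg_def[of X] E_num_deg)
  finally show ?thesis .
qed

text \<open>Given the state of the edge between \<open>u\<close> and \<open>v\<close>, the two
  degrees depend on disjoint edge sets and hit \<open>d\<close> with the same conditional
  probability. The mean of its square is at least the square of its mean.\<close>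

lemma deg_pair_correlation:
  assumes uv: "u \<in> {1..n}" "v \<in> {1..n}" "u \<noteq> v"
  shows "tau\<^sup>2 \<le> E (\<lambda>X. of_bool (deg n u X = d) * of_bool (deg n v X = d))"
proof -
  define e where "e = {u, v}"
  have e: "e \<in> I" "e \<in> incident n u" "e \<in> incident n v"
    using uv by (auto simp: e_def vertex_pairs_def incident_def)
  define A where "A = (\<lambda>w. incident n w - {e})"
  define a where "a = (\<lambda>k. binom_prob (n - 2) p k)"
  have A: "A w \<subseteq> I" "card (A w) = n - 2" if "w = u \<or> w = v" for w
    using that uv e incident_subset[of n w] finite_incident[of n w]
    by (auto simp: A_def card_Diff_singleton card_incident)
  have disj: "A u \<inter> A v = {}"
  proof -
    have "f = e" if "f \<in> I" "u \<in> f" "v \<in> f" for f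
    proof -
      have "e \<subseteq> f" "card e = card f" "finite f"
        using that e(1) vertex_pairsD[of f n] vertex_pairsD[of e n] by (auto simp: e_def)
      then show ?thesis using card_subset_eq by metis
    qed
    then show ?thesis by (auto simp: A_def incident_def)
  qed
  have marg: "E (\<lambda>X. of_bool (num_true (A w) X = k)) = a k" if "w = u \<or> w = v" for w k
    using E_num_true_eq[OF p_pos p_less_1 A(1)[OF that]] A(2)[OF that] by (simp add: a_def)
  have upd: "deg n w (X(e := b)) = num_true (A w) X + of_bool b" if "w = u \<or> w = v" for w X b
    unfolding A_def by (rule num_true_upd) (use that e finite_incident in auto)
  have split: "(d = k + 1) = (k = d - 1)" "(Suc k = d) = (k = d - 1)" for k
    using d_pos by auto
  have "tau = E (coord_avg p e (\<lambda>X. of_bool (deg n u X = d)))"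
    using E_deg_eq[OF uv(1)] E_coord_avg[OF e(1)] by simp
  also have "\<dots> = p * a (d - 1) + (1 - p) * a d"
    unfolding coord_avg_def[abs_def] using marg[of u]
    by (simp add: upd split E_add E_cmult)
  finally have tau: "tau = p * a (d - 1) + (1 - p) * a d" .
  have indep: "E (\<lambda>X. of_bool (num_true (A u) X = k) * of_bool (num_true (A v) X = k)) = (a k)\<^sup>2" for k
  proof -
    have "E (\<lambda>X. of_bool (num_true (A u) X = k) * of_bool (num_true (A v) X = k)) =
        E (\<lambda>X. of_bool (num_true (A u) X = k)) * E (\<lambda>X. of_bool (num_true (A v) X = k))"
    proof (rule E_mult_indep)
      fix f assume "f \<in> I"
      have "ignores (\<lambda>X. of_bool (num_true (A w) X = k) :: real) f" if "f \<notin> A w" for w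
        using num_true_ignores[OF that] by (simp add: ignores_def)
      then show "ignores (\<lambda>X. of_bool (num_true (A u) X = k) :: real) f \<or>
          ignores (\<lambda>X. of_bool (num_true (A v) X = k) :: real) f"
        using disj by blast
    qed
    then show ?thesis using marg by (simp add: power2_eq_square)
  qed
  have "tau\<^sup>2 \<le> p * (a (d - 1))\<^sup>2 + (1 - p) * (a d)\<^sup>2"
    unfolding tau using p_pos p_less_1 by (intro convex_square) auto
  also have "\<dots> = E (coord_avg p e (\<lambda>X. of_bool (deg n u X = d) * of_bool (deg n v X = d)))"
    unfolding coord_avg_def[abs_def] indep[symmetric]
    by (simp add: upd split E_add E_cmult)
  also have "\<dots> = E (\<lambda>X. of_bool (deg n u X = d) * of_bool (deg n v X = d))"
    by (rule E_coord_avg[OF e(1)])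
  finally show ?thesis .
qed

text \<open>Each row of the second moment has diagonal entry \<open>tau\<close> and off-diagonal
  entries at least \<open>tau\<^sup>2\<close>; subtracting the squared mean leaves the variance of
  independent indicators.\<close>

lemma variance_num_deg_ge: "real n * tau * (1 - tau) \<le> E (\<lambda>X. (num_deg X - E num_deg)\<^sup>2)"
proof -
  let ?F = "\<lambda>u v. E (\<lambda>X. of_bool (deg n u X = d) * of_bool (deg n v X = d))"
  have row: "tau + (real n - 1) * tau\<^sup>2 \<le> (\<Sum>v\<in>{1..n}. ?F u v)" if "u \<in> {1..n}" for u
  proof -
    have "tau + (real n - 1) * tau\<^sup>2 = tau + (\<Sum>v\<in>{1..n} - {u}. tau\<^sup>2)"
      using that by (simp add: of_nat_diff)
    also have "\<dots> \<le> ?F u u + (\<Sum>v\<in>{1..n} - {u}. ?F u v)"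
      using that E_deg_eq[OF that] by (intro add_mono sum_mono deg_pair_correlation) (auto simp flip: of_bool_conj)
    also have "\<dots> = (\<Sum>v\<in>{1..n}. ?F u v)"
      using that by (subst sum.remove[of _ u]) auto
    finally show ?thesis .
  qed
  have "real n * tau * (1 - tau) = (\<Sum>u\<in>{1..n}. tau + (real n - 1) * tau\<^sup>2) - (real n * tau)\<^sup>2"
    by (simp add: power2_eq_square algebra_simps)
  also have "\<dots> \<le> (\<Sum>u\<in>{1..n}. \<Sum>v\<in>{1..n}. ?F u v) - (real n * tau)\<^sup>2"
    by (intro diff_right_mono sum_mono row)
  also have "(\<Sum>u\<in>{1..n}. \<Sum>v\<in>{1..n}. ?F u v) = E (\<lambda>X. (num_deg X)\<^sup>2)"
    unfolding num_deg_def power2_eq_square sum_product E_sum ..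
  finally show ?thesis using E_variance[of num_deg] by (simp add: E_num_deg)
qed

lemma kolmogorov_bound:
  assumes K: "\<And>k. \<bar>binom_step d (n - 1) p k\<bar> \<le> K"
    and s2: "s2 = E (\<lambda>X. (num_deg X - E num_deg)\<^sup>2)" "0 < s2"
    and b: "theta \<le> b"
  shows "\<bar>E (\<lambda>X. of_bool ((num_deg X - E num_deg) / sqrt s2 \<le> z)) - Phi z\<bar> \<le>
    48 * K * (1 + b) * sqrt (real n * theta ^ d) / s2"
proof -
  let ?h = poisson_sol and ?Y = num_deg
  have K0: "0 \<le> K" using K[of 0] by linarith
  have b0: "0 \<le> b" using theta_nonneg b by linarith
  have h: "\<bar>coord_diff e ?h X\<bar> \<le> 2 * K" if "e \<in> I" for e X
    unfolding coord_diff_poisson_sol[OF that]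
    using vertex_pairsD[OF that] by (intro order_trans[OF sum_abs] order_trans[OF sum_bounded_above[OF K]]) simp
  have Y: "\<bar>coord_diff e ?Y X\<bar> \<le> near n d 1 e X" if "e \<in> I" for e X
    unfolding num_deg_def[abs_def] coord_diff_vertex_sum[OF that, where \<phi> = "\<lambda>k. of_bool (k = d)"] near_def
  proof (rule order_trans[OF sum_abs sum_mono])
    fix v
    show "\<bar>of_bool (deg n v (X(e := False)) + 1 = d) - of_bool (deg n v (X(e := False)) = d) :: real\<bar>
        \<le> of_bool (d - 1 \<le> deg n v X)"
      using deg_False_le[of n v X e] by auto
  qed
  have prod: "\<bar>coord_diff e ?h X * coord_diff e ?Y X\<bar> \<le> 2 * K * near n d 1 e X" if "e \<in> I" for e X
    unfolding abs_mult using h[OF that] Y[OF that] K0 by (intro mult_mono) auto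
  have loc: "ignores (coord_diff e ?h) f" "ignores (coord_diff e ?Y) f" if "e \<in> I" "e \<inter> f = {}" for e f
    using coord_diff_vertex_sum_ignores[OF that, of "\<lambda>k. \<Sum>j<k. binom_step d (n - 1) p j"]
      coord_diff_vertex_sum_ignores[OF that, of "\<lambda>k. of_bool (k = d)"]
    by (simp_all only: poisson_sol_def[abs_def] num_deg_def[abs_def])
  define T where "T = (\<lambda>X. \<Sum>e\<in>I. p * (1 - p) * (coord_diff e ?h X * coord_diff e ?Y X))"
  define R where "R = (\<lambda>X. \<Sum>e\<in>I. (of_bool (X e) - p) * (\<bar>coord_diff e ?h X\<bar> * coord_diff e ?Y X))"
  have T_mean: "E T = s2"
    unfolding T_def by (rule stein_bernoulli(1)[OF poisson_sol_eq s2])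
  have stein: "\<bar>E (\<lambda>X. of_bool ((?Y X - E ?Y) / sqrt s2 \<le> z)) - Phi z\<bar> \<le>
      2 / s2 * (E (\<lambda>X. \<bar>T X - s2\<bar>) + E (\<lambda>X. \<bar>R X\<bar>))"
    unfolding T_def R_def by (rule stein_bernoulli(2)[OF poisson_sol_eq s2])
  \<comment> \<open>A common bound for both second moments. \<open>2 * K\<close> bounds the
    increments of the Poisson solution, one \<open>K\<close> per endpoint, and 36 dominates the
    constants of both estimates while being a square, so the root is
    \<open>12 * K * (1 + b) * sqrt S\<close>.\<close>
  let ?M = "36 * (2 * K)\<^sup>2 * (1 + b)\<^sup>2 * (real n * theta ^ d)"
  have pow: "theta * theta ^ (d - 1) = theta ^ d" "theta\<^sup>2 * theta ^ (d - 2) \<le> (1 + b) * theta ^ d"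
  proof -
    show "theta * theta ^ (d - 1) = theta ^ d" using d_pos by (simp flip: power_Suc)
    show "theta\<^sup>2 * theta ^ (d - 2) \<le> (1 + b) * theta ^ d"
    \<comment> \<open>For \<open>d = 1\<close> the exponent \<open>d - 2\<close> truncates to 0, so
      the left side is \<open>theta\<^sup>2\<close> against \<open>theta\<close>; the surplus factor
      is at most \<open>b\<close>.\<close>
    proof (cases "d = 1")
      case True
      have "theta * theta \<le> (1 + b) * theta"
        using b theta_nonneg by (intro mult_right_mono) auto
      then show ?thesis using True by (simp add: power2_eq_square)
    next
      case False
      then have "2 + (d - 2) = d" using d_pos by simp
      then have "theta\<^sup>2 * theta ^ (d - 2) = theta ^ d" by (metis power_add)
      moreover have "0 \<le> b * theta ^ d" using b0 theta_nonneg by simp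
      ultimately show ?thesis by (simp add: distrib_right)
    qed
  qed
  define S where "S = real n * theta ^ d"
  have S0: "0 \<le> S" using theta_nonneg by (simp add: S_def)
  have R2: "E (\<lambda>X. (R X)\<^sup>2) \<le> ?M"
  proof -
    have "E (\<lambda>X. (R X)\<^sup>2) \<le>
        2 * (2 * K)\<^sup>2 * real n * theta * theta ^ (d - 1) + 16 * (2 * K)\<^sup>2 * real n * theta\<^sup>2 * theta ^ (d - 2)"
      unfolding R_def
    proof (rule divergence_second_moment)
      show "\<bar>\<bar>coord_diff e ?h X\<bar> * coord_diff e ?Y X\<bar> \<le> 2 * K * near n d 1 e X" if "e \<in> I" for e X
        using prod[OF that] by (simp add: abs_mult)
      show "ignores (\<lambda>X. \<bar>coord_diff e ?h X\<bar> * coord_diff e ?Y X) e" for e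
        by (simp add: ignores_def coord_diff_def)
      show "ignores (\<lambda>X. \<bar>coord_diff e ?h X\<bar> * coord_diff e ?Y X) f" if "e \<in> I" "e \<inter> f = {}" for e f
        using loc[OF that] by (simp add: ignores_def)
    qed (use K0 in auto)
    also have "\<dots> = (2 * K)\<^sup>2 * real n * (2 * (theta * theta ^ (d - 1)) + 16 * (theta\<^sup>2 * theta ^ (d - 2)))"
      by (simp add: algebra_simps)
    also have "\<dots> \<le> (2 * K)\<^sup>2 * real n * (2 * theta ^ d + 16 * ((1 + b) * theta ^ d))"
      using pow by (intro mult_left_mono) auto
    also have "\<dots> = (2 * K)\<^sup>2 * (18 + 16 * b) * S" by (simp add: S_def algebra_simps)
    also have "\<dots> \<le> (2 * K)\<^sup>2 * (36 * (1 + b)\<^sup>2) * S"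
    proof (intro mult_left_mono mult_right_mono S0)
      show "18 + 16 * b \<le> 36 * (1 + b)\<^sup>2" using b0 by (simp add: power2_eq_square algebra_simps)
    qed simp
    finally show ?thesis by (simp add: S_def mult_ac)
  qed
  have T2: "E (\<lambda>X. (T X - E T)\<^sup>2) \<le> ?M"
  proof -
    have "E (\<lambda>X. (T X - E T)\<^sup>2) \<le> 32 * (2 * K)\<^sup>2 * real n * theta * theta\<^sup>2 * theta ^ (d - 2)"
      unfolding T_def
    proof (rule edge_sum_variance)
      show "ignores (\<lambda>X. coord_diff e ?h X * coord_diff e ?Y X) e" for e
        by (simp add: ignores_def coord_diff_def)
      show "ignores (\<lambda>X. coord_diff e ?h X * coord_diff e ?Y X) f" if "e \<in> I" "e \<inter> f = {}" for e f
        using loc[OF that] by (simp add: ignores_def)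
    qed (use K0 prod in auto)
    also have "\<dots> = 32 * (2 * K)\<^sup>2 * real n * (theta * (theta\<^sup>2 * theta ^ (d - 2)))"
      by (simp add: mult_ac)
    also have "\<dots> \<le> 32 * (2 * K)\<^sup>2 * real n * (b * ((1 + b) * theta ^ d))"
    proof (rule mult_left_mono)
      show "theta * (theta\<^sup>2 * theta ^ (d - 2)) \<le> b * ((1 + b) * theta ^ d)"
        using b0 theta_nonneg by (intro mult_mono b pow(2)) auto
    qed simp
    also have "\<dots> = (2 * K)\<^sup>2 * (32 * b * (1 + b)) * S" by (simp add: S_def mult_ac)
    also have "\<dots> \<le> (2 * K)\<^sup>2 * (36 * (1 + b)\<^sup>2) * S"
    proof (intro mult_left_mono mult_right_mono S0)
      show "32 * b * (1 + b) \<le> 36 * (1 + b)\<^sup>2" using b0 by (simp add: power2_eq_square algebra_simps)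
    qed simp
    finally show ?thesis by (simp add: S_def mult_ac)
  qed
  have sqrt_M: "sqrt ?M = 12 * K * (1 + b) * sqrt S"
  proof -
    have "?M = (12 * K * (1 + b))\<^sup>2 * S" by (simp add: S_def power_mult_distrib)
    then show ?thesis using K0 b0 by (simp add: real_sqrt_mult real_sqrt_abs abs_mult)
  qed
  have "E (\<lambda>X. \<bar>T X - s2\<bar>) \<le> 12 * K * (1 + b) * sqrt S"
    using E_abs_le_sqrt[of "\<lambda>X. T X - s2"] real_sqrt_le_mono[OF T2] unfolding T_mean sqrt_M by (rule order_trans)
  moreover have "E (\<lambda>X. \<bar>R X\<bar>) \<le> 12 * K * (1 + b) * sqrt S"
    using E_abs_le_sqrt[of R] real_sqrt_le_mono[OF R2] unfolding sqrt_M by (rule order_trans)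
  ultimately have "2 / s2 * (E (\<lambda>X. \<bar>T X - s2\<bar>) + E (\<lambda>X. \<bar>R X\<bar>)) \<le> 2 / s2 * (24 * K * (1 + b) * sqrt S)"
    using s2(2) by (intro mult_left_mono) auto
  also have "\<dots> = 48 * K * (1 + b) * sqrt (real n * theta ^ d) / s2" by (simp add: S_def)
  finally show ?thesis using stein by linarith
qed

text \<open>For \<open>p\<close> at most one half, \<open>ln (1 - p)\<close> is at least
  \<open>- p - 2 * p\<^sup>2\<close>, hence at least \<open>- 2 * p\<close>.\<close>

lemma one_minus_p_power_ge:
  assumes "p \<le> 1 / 2"
  shows "exp (- 2 * theta) \<le> (1 - p) ^ (n - 1)"
proof -
  have "- 2 * p \<le> - p - 2 * p\<^sup>2"
    using assms p_pos mult_left_mono[of p "1 / 2" p] by (simp add: power2_eq_square)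
  also have "\<dots> \<le> ln (1 - p)"
    using ln_one_minus_pos_lower_bound[of p] assms p_pos by simp
  finally have "exp (- 2 * p) \<le> 1 - p"
    using p_less_1 by (simp add: ln_ge_iff)
  then have "exp (- 2 * p) ^ (n - 1) \<le> (1 - p) ^ (n - 1)" by (rule power_mono) simp
  also have "exp (- 2 * p) ^ (n - 1) = exp (- 2 * theta)"
    by (simp add: theta_def exp_of_nat_mult[symmetric] mult_ac)
  finally show ?thesis .
qed

text \<open>In \<open>n * tau * (1 - tau)\<close> both \<open>tau\<close> and \<open>1 - tau\<close>
  cost a factor \<open>exp (- 2 * b)\<close>: the first through the power of \<open>1 - p\<close>,
  the second because degree 0, which differs from \<open>d\<close>, has at least that
  probability.\<close>

lemma variance_num_deg_ge_power:
  assumes "p \<le> 1 / 2" and b: "theta \<le> b"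
  shows "exp (- 4 * b) / real d ^ d * (real n * theta ^ d) \<le> E (\<lambda>X. (num_deg X - E num_deg)\<^sup>2)"
proof -
  let ?m = "n - 1"
  have q: "exp (- 2 * b) \<le> (1 - p) ^ ?m"
    using b by (intro order_trans[OF _ one_minus_p_power_ge[OF assms(1)]]) simp
  have tau_ge: "theta ^ d / real d ^ d * exp (- 2 * b) \<le> tau"
  proof -
    have "(1 - p) ^ ?m \<le> (1 - p) ^ (?m - d)"
      using p_pos p_less_1 by (intro power_decreasing) auto
    with q have "exp (- 2 * b) \<le> (1 - p) ^ (?m - d)" by linarith
    moreover have "(real ?m / real d) ^ d \<le> real (?m choose d)"
      using d_less by (intro binomial_ge_n_over_k_pow_k) auto
    ultimately have "(real ?m / real d) ^ d * p ^ d * exp (- 2 * b) \<le> real (?m choose d) * p ^ d * (1 - p) ^ (?m - d)"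
      using p_pos by (intro mult_mono) auto
    then show ?thesis by (simp add: tau_def binom_prob_def theta_def power_mult_distrib power_divide)
  qed
  have tau_le: "exp (- 2 * b) \<le> 1 - tau"
  proof -
    have "(\<Sum>k\<in>{0, d}. binom_prob ?m p k) \<le> (\<Sum>k\<le>?m. binom_prob ?m p k)"
      using d_less p_pos p_less_1 by (intro sum_mono2) (auto simp: binom_prob_nonneg)
    then have "binom_prob ?m p 0 + tau \<le> 1"
      using d_pos by (simp add: sum_binom_prob tau_def)
    then show ?thesis using q by (simp add: binom_prob_def)
  qed
  have "exp (- 4 * b) / real d ^ d * (real n * theta ^ d) =
      real n * (theta ^ d / real d ^ d * exp (- 2 * b)) * exp (- 2 * b)"
    by (simp add: exp_add[symmetric] mult_ac)
  also have "\<dots> \<le> real n * tau * (1 - tau)"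
  proof (intro mult_mono tau_ge tau_le)
    have "0 \<le> tau" using p_pos p_less_1 by (simp add: tau_def binom_prob_nonneg)
    then show "0 \<le> real n * tau" by simp
  qed (use theta_nonneg in auto)
  also have "\<dots> \<le> E (\<lambda>X. (num_deg X - E num_deg)\<^sup>2)" by (rule variance_num_deg_ge)
  finally show ?thesis .
qed

text \<open>The numerator is of order \<open>sqrt S\<close> and the variance at least of order
  \<open>S\<close>, whence the rate \<open>1 / sqrt S\<close>.\<close>

lemma kolmogorov_rate:
  assumes "p \<le> 1 / 2" and b: "theta \<le> b" "0 < b"
    and s2: "s2 = E (\<lambda>X. (num_deg X - E num_deg)\<^sup>2)"
  shows "\<bar>E (\<lambda>X. of_bool ((num_deg X - E num_deg) / sqrt s2 \<le> z)) - Phi z\<bar> \<le>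
    48 * ((1 + b) ^ d * exp (2 * b)) * (1 + b) * (real d ^ d * exp (4 * b)) / sqrt (real n * theta ^ d)"
proof -
  let ?K = "(1 + b) ^ d * exp (2 * b)"
  define S where "S = real n * theta ^ d"
  have S: "0 < S"
    using d_pos d_less p_pos by (simp add: S_def theta_def)
  have K: "\<bar>binom_step d (n - 1) p k\<bar> \<le> ?K" for k
  proof -
    have "\<bar>binom_step d (n - 1) p k\<bar> \<le> (1 + theta) ^ d / (1 - p) ^ (n - 1)"
      using binom_step_bound[OF p_pos p_less_1, of d "n - 1" k] d_less by (simp add: theta_def)
    also have "\<dots> \<le> (1 + b) ^ d / exp (- 2 * b)"
    proof (rule frac_le)
      show "exp (- 2 * b) \<le> (1 - p) ^ (n - 1)"
        using b by (intro order_trans[OF _ one_minus_p_power_ge[OF assms(1)]]) simp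
    qed (use b theta_nonneg in \<open>auto intro: power_mono\<close>)
    also have "\<dots> = ?K" by (simp add: exp_minus field_simps)
    finally show ?thesis .
  qed
  have ge: "exp (- 4 * b) / real d ^ d * S \<le> s2"
    unfolding S_def s2 by (rule variance_num_deg_ge_power[OF assms(1) b(1)])
  have pos: "0 < exp (- 4 * b) / real d ^ d * S" using S d_pos by simp
  then have s2_pos: "0 < s2" using ge by linarith
  have "\<bar>E (\<lambda>X. of_bool ((num_deg X - E num_deg) / sqrt s2 \<le> z)) - Phi z\<bar> \<le>
      48 * ?K * (1 + b) * sqrt S / s2"
    unfolding S_def using s2_pos by (intro kolmogorov_bound K s2 b)
  also have "\<dots> \<le> 48 * ?K * (1 + b) * sqrt S / (exp (- 4 * b) / real d ^ d * S)"
    using S b by (intro divide_left_mono[OF ge _ mult_pos_pos[OF s2_pos pos]]) simp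
  also have "\<dots> = 48 * ?K * (1 + b) * (real d ^ d * exp (4 * b)) * (sqrt S / S)"
    by (simp add: exp_minus field_simps)
  also have "sqrt S / S = 1 / sqrt S"
    using S by (simp add: field_simps)
  finally show ?thesis by (simp add: S_def)
qed

end

section \<open>Uniform constants and the case of few vertices\<close>

theorem theorem2p1:
  fixes d :: nat and b :: real
  assumes "d \<ge> 1" and "b > 0"
  shows "\<exists>C::real. \<forall>n::nat. n \<ge> d + 1 \<longrightarrow>
    (\<forall>\<theta>\<in>{0<..<real n - 1} \<inter> {0<..b}.
      (SUP z::real. \<bar>measure_pmf.prob (G_dist n \<theta>) {G. W_std d n \<theta> G \<le> z}
                     - measure std_normal_distribution {..z}\<bar>)
        \<le> C / r_rate d n \<theta>)"
proof -
  define C0 where "C0 = 48 * ((1 + b) ^ d * exp (2 * b)) * (1 + b) * (real d ^ d * exp (4 * b))"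
  \<comment> \<open>This bounds the rate when \<open>n < 2 * b + 1\<close>. There \<open>p\<close>
    may exceed one half, and the trivial bound 1 on the distance is then enough.\<close>
  define C1 where "C1 = sqrt ((2 * b + 1) * b ^ d)"
  have C_nonneg: "0 \<le> C0" "0 \<le> C1" using assms by (simp_all add: C0_def C1_def)
  have "\<bar>measure_pmf.prob (G_dist n \<theta>) {G. W_std d n \<theta> G \<le> z} - measure std_normal_distribution {..z}\<bar>
      \<le> (C0 + C1) / r_rate d n \<theta>"
    if n: "d + 1 \<le> n" and \<theta>: "0 < \<theta>" "\<theta> < real n - 1" "\<theta> \<le> b" for n \<theta> z
  proof -
    define p where "p = \<theta> / (real n - 1)"
    have n1: "real (n - 1) = real n - 1" "0 < real n - 1" using n assms by (auto simp: of_nat_diff)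
    interpret er_graph n d p
      using assms n \<theta> n1 by unfold_locales (auto simp: p_def)
    have theta: "theta = \<theta>" unfolding theta_def n1(1) using n1(2) by (simp add: p_def)
    have G: "G_dist n \<theta> = Pi_pmf I False (\<lambda>_. bernoulli_pmf p)"
      by (simp add: G_dist_def erdos_renyi_def p_def)
    have Y: "Y_count d n = num_deg"
      by (simp add: Y_count_def num_deg_def vdegree_eq_num_true fun_eq_iff)
    define s2 where "s2 = E (\<lambda>X. (num_deg X - E num_deg)\<^sup>2)"
    have W: "W_std d n \<theta> X = (num_deg X - E num_deg) / sqrt s2" for X
      by (simp add: W_std_def mean_Y_def sigma_Y_def G Y s2_def bern_exp_def)
    have prob: "measure_pmf.prob (G_dist n \<theta>) {G. W_std d n \<theta> G \<le> z} =
        E (\<lambda>X. of_bool ((num_deg X - E num_deg) / sqrt s2 \<le> z))"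
    proof -
      have "measure_pmf.prob (G_dist n \<theta>) {G. W_std d n \<theta> G \<le> z} =
          measure_pmf.expectation (G_dist n \<theta>) (indicator {G. W_std d n \<theta> G \<le> z})" by simp
      also have "indicator {G. W_std d n \<theta> G \<le> z} = (\<lambda>X. of_bool ((num_deg X - E num_deg) / sqrt s2 \<le> z) :: real)"
        by (simp add: indicator_def W fun_eq_iff)
      finally show ?thesis by (simp add: bern_exp_def G)
    qed
    have r_pos: "0 < r_rate d n \<theta>"
      using n \<theta> by (simp add: r_rate_def tau_poisson_def)
    \<comment> \<open>The factor \<open>exp (- \<theta>) / fact d\<close> is at most 1, so a bound
      in terms of \<open>n * \<theta> ^ d\<close> is stronger than one in terms of the Poisson
      rate.\<close>
    have r_le: "r_rate d n \<theta> \<le> sqrt (real n * \<theta> ^ d)"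
    proof -
      have "exp (- \<theta>) * \<theta> ^ d \<le> 1 * \<theta> ^ d" using \<theta> by (intro mult_right_mono) auto
      then have "exp (- \<theta>) * \<theta> ^ d / fact d \<le> \<theta> ^ d / 1"
        using \<theta> by (intro frac_le) (auto simp: fact_ge_1)
      then show ?thesis
        unfolding r_rate_def tau_poisson_def by (intro real_sqrt_le_mono mult_left_mono) auto
    qed
    show ?thesis
    proof (cases "2 * b \<le> real n - 1")
      case True
      then have p_half: "p \<le> 1 / 2" using \<theta> n1 by (simp add: p_def field_simps)
      have "\<bar>E (\<lambda>X. of_bool ((num_deg X - E num_deg) / sqrt s2 \<le> z)) - Phi z\<bar> \<le> C0 / sqrt (real n * \<theta> ^ d)"
        using kolmogorov_rate[OF p_half _ assms(2) s2_def, of z] \<theta> unfolding theta C0_def by blast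
      also have "\<dots> \<le> (C0 + C1) / r_rate d n \<theta>"
        using C_nonneg r_pos r_le by (intro frac_le) auto
      finally show ?thesis by (simp add: prob cdf_def)
    next
      case False
      have "r_rate d n \<theta> \<le> C1"
        using r_le
      proof (rule order_trans)
        show "sqrt (real n * \<theta> ^ d) \<le> C1"
          unfolding C1_def using False \<theta> by (intro real_sqrt_le_mono mult_mono power_mono) auto
      qed
      then have "1 \<le> (C0 + C1) / r_rate d n \<theta>" using r_pos C_nonneg by (simp add: le_divide_eq)
      moreover have "\<bar>measure_pmf.prob (G_dist n \<theta>) {G. W_std d n \<theta> G \<le> z} - Phi z\<bar> \<le> 1"
        using measure_pmf.prob_le_1[of "G_dist n \<theta>" "{G. W_std d n \<theta> G \<le> z}"]
          measure_nonneg[of "measure_pmf (G_dist n \<theta>)" "{G. W_std d n \<theta> G \<le> z}"]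
          std_normal.cdf_nonneg[of z] std_normal.cdf_bounded_prob[of z]
        by linarith
      ultimately show ?thesis by (simp add: cdf_def)
    qed
  qed
  then show ?thesis
    by (intro exI[of _ "C0 + C1"]) (auto intro!: cSUP_least)
qed

end
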